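(* For all non-negative integers $x,y,z,a$, the number of lozenge tilings of the region $\mathcal{R}_{x,y,z}(a)$ equals $P_1(x,y,z,a)$.
   Context: Triangular lattice with horizontal lattice lines. The regions considered are pentagonal regions bounded by a horizontal northern side, a northeastern side and a western side each following a zig-zag lattice path, a straight southeastern side, and a horizontal southern side (so that for such a pentagon with northern side $x$ and southeastern side $n$, the northeastern and western zig-zag sides have length $n$ and the southern side has length $x+n-1$). $\mathcal{R}_{x,y,z}(a)$ is obtained as follows: take such a pentagonal region whose northern, northeastern, southeastern, southern and western sides have lengths $x,\ y+z+2a,\ y+z,\ x+y+z+3a-1,\ y+z+a$; remove the $(y+1)$-st through $(y+a)$-th up-pointing unit triangles on the western side (counting from top to bottom); then remove the lozenges forced by this removal, producing a semi-triangular hole on the western side. Pochhammer: $(x)_n=x(x+1)\cdots(x+n-1)$ ($n>0$), $(x)_0=1$, $(x)_{-n}=1/((x-1)\cdots(x-n))$. Skipped Pochhammer: $[x]_n=x(x+2)\cdots(x+2n-2)$ ($n>0$), $[x]_0=1$, $[x]_n=1/((x-2)(x-4)\cdots(x+2n))$ ($n<0$). \begin{align*} P_1(x,y,z,a)&=\frac{1}{2^{y+z}}\prod_{i=1}^{y+z}\frac{(2x+6a+2i)_i[2x+6a+4i+1]_{i-1}}{(i)_i[2x+6a+2i+1]_{i-1}}\\ &\times\prod_{i=1}^{a}\frac{(z+i)_{y+a-2i+1}(x+y+2z+2a+2i)_{2y+2a-4i+2}(x+3i-2)_{y-i+1}(x+3y+2i-1)_{i-1}}{(i)_y(y+2z+2i-1)_{y+2a-4i+3}(2z+2i)_{y+2a-4i+1}(x+y+z+2a+i)_{y+a-2i+1}}.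 \end{align*} *)

theory Defs
  imports Complex_Main
begin

definition poch :: "real \<Rightarrow> int \<Rightarrow> real" where
  "poch x n = (if 0 \<le> n then pochhammer x (nat n)
               else inverse (\<Prod>i\<in>{1..nat (- n)}. x - real i))"

definition spoch :: "real \<Rightarrow> int \<Rightarrow> real" where
  "spoch x n = (if 0 \<le> n then (\<Prod>i<nat n. x + 2 * real i)
                else inverse (\<Prod>i\<in>{1..nat (- n)}. x - 2 * real i))"

definition P1 :: "nat \<Rightarrow> nat \<Rightarrow> nat \<Rightarrow> nat \<Rightarrow> real" where
  "P1 x y z a =
     (1 / 2 ^ (y + z)) *
     (\<Prod>i\<in>{1..y+z}.
        poch (2 * real x + 6 * real a + 2 * real i) (int i)
        * spoch (2 * real x + 6 * real a + 4 * real i + 1) (int i - 1)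
        / (poch (real i) (int i) * spoch (2 * real x + 6 * real a + 2 * real i + 1) (int i - 1))) *
     (\<Prod>i\<in>{1..a}.
        poch (real z + real i) (int y + int a - 2 * int i + 1)
        * poch (real x + real y + 2 * real z + 2 * real a + 2 * real i) (2 * int y + 2 * int a - 4 * int i + 2)
        * poch (real x + 3 * real i - 2) (int y - int i + 1)
        * poch (real x + 3 * real y + 2 * real i - 1) (int i - 1)
        / (poch (real i) (int y)
           * poch (real y + 2 * real z + 2 * real i - 1) (int y + 2 * int a - 4 * int i + 3)
           * poch (2 * real z + 2 * real i) (int y + 2 * int a - 4 * int i + 1)
           * poch (real x + real y + real z + 2 * real a + real i) (int y + int a - 2 * int i + 1)))"

text \<open>
  The triangular lattice has horizontal lattice lines.  Lattice points are
  (p + q/2, q*sqrt 3/2); we use doubled horizontal coordinates so that all lattice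
  points have integer coordinates.  The horizontal strips between consecutive lattice
  lines ("rows") are numbered r = ..., 0, 1, 2, ... from top to bottom.  A unit triangle
  is encoded by the pair (r, c): r is its row and c is the (doubled) horizontal
  coordinate of its vertical axis of symmetry (i.e. of its apex, resp. of its bottom vertex).
  Within a row, consecutive triangles have consecutive c and alternate between up- and
  down-pointing; we normalise so that (r, c) is up-pointing iff r + c is even.
  Two unit triangles share an edge (i.e. form a lozenge) iff they are horizontal neighbours
  in the same row, or an up-pointing triangle in row r sits directly above (same c) a
  down-pointing triangle in row r+1 (they share the horizontal edge).
\<close>

type_synonym tri = "int \<times> int"

definition is_up :: "tri \<Rightarrow> bool" where
  "is_up t \<longleftrightarrow> even (fst t + snd t)"

definition adj :: "tri \<Rightarrow> tri \<Rightarrow> bool" where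
  "adj s t \<longleftrightarrow>
     (fst s = fst t \<and> \<bar>snd s - snd t\<bar> = 1) \<or>
     (snd s = snd t \<and> ((fst t = fst s + 1 \<and> is_up s) \<or> (fst s = fst t + 1 \<and> is_up t)))"

definition is_lozenge :: "tri set \<Rightarrow> bool" where
  "is_lozenge L \<longleftrightarrow> (\<exists>s t. adj s t \<and> L = {s, t})"

definition lozenge_tilings :: "tri set \<Rightarrow> tri set set set" where
  "lozenge_tilings R = {T. (\<forall>L\<in>T. is_lozenge L) \<and> pairwise disjnt T \<and> \<Union>T = R}"

text \<open>
  Pentagonal region with northern side x (horizontal), northeastern zig-zag side of
  length m (m down-right unit steps separated by m-1 horizontal unit steps),
  straight southeastern side of length k, horizontal southern side of length
  x + (3m - k)/2 - 1 and a vertical western zig-zag side with (m+k)/2 teeth.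
  It has m + k rows (rows 0 .. m+k-1 from the top); every row starts on the left
  at c = 0 (the western zig-zag), and row r ends on the right at
  c = 2x + 3r for r < m (the northeastern zig-zag) and at c = 2x + 3m - 3 - (r - m)
  for m \<le> r < m+k (the southeastern side).  For m = k = n this is the pentagon with
  sides x, n, n, x+n-1, n.
  The leftmost triangle (r, 0) of row r is up-pointing iff r is even; these are the
  up-pointing unit triangles on the western side, the i-th one from the top
  being (2(i-1), 0).
\<close>

definition pentagon :: "nat \<Rightarrow> nat \<Rightarrow> nat \<Rightarrow> tri set" where
  "pentagon x m k =
     {(r, c). 0 \<le> r \<and> r < int m + int k \<and> 0 \<le> c \<and>
              c \<le> (if r < int m then 2 * int x + 3 * r
                   else 2 * int x + 3 * int m - 3 - (r - int m))}"

definition west_up :: "nat \<Rightarrow> tri" where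
  "west_up i = (2 * (int i - 1), 0)"

definition region_R :: "nat \<Rightarrow> nat \<Rightarrow> nat \<Rightarrow> nat \<Rightarrow> tri set" where
  "region_R x y z a = pentagon x (y + z + 2 * a) (y + z) - west_up ` {y + 1 .. y + a}"

end

theory Submission
  imports Defs "Jordan_Normal_Form.Determinant"
begin

text \<open>
  Tilings are counted row by row. The paths of lozenges that start on the northeastern side and leave
  through the western one cross each horizontal lattice line at positions that interlace with those on the
  next line, and summing a determinant over interlacing positions amounts to summing within its rows.
  So the number of tilings is a determinant of binomial coefficients with one row per start and one
  column per exit row: all odd rows, and an additional block of \<open>a\<close> even rows for the hole.

  For \<open>a \<le> 1\<close> an explicit hypergeometric combination of the rows vanishes in all odd columns and takes product
  values in the even ones. Deleting the first row only shifts the parameters, so that the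
  determinants for larger \<open>a\<close> are linked by Dodgson condensation, with all the terms in one family;
  the product formula satisfies the same recurrence because its quotients reduce to
  a polynomial identity.
\<close>

section \<open>Determinants indexed by lists of rows and columns\<close>

text \<open>The row combination is not a lucky guess. There are \<open>N\<close> odd columns and
  \<open>N + 1\<close> rows, and the first \<open>N\<close> rows form an invertible block there, so
  a combination that vanishes in all odd columns is unique up to scaling. If it starts with
  coefficient 1, its last coefficient is the quotient of the determinant without a hole by the one
  with the single even column 0. That column meets only row 0, so the second determinant is, up to
  sign, again one without a hole, for \<open>x + 3\<close> and \<open>N - 1\<close>. Hence the
  closed form of one coefficient already settles \<open>a = 0\<close>; the other even columns give
  \<open>a = 1\<close>.

  Two obstacles shape the rest. The tiling count takes the exits in their natural order, whereas the
  row combination wants odd and even columns in separate blocks; the sign of this reordering is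
  carried along, because condensation subtracts. And condensation divides by an inner determinant,
  known to be nonzero only because its product formula is positive. So formula, sign and
  nonvanishing are established in one induction.\<close>

text \<open>Rows are functions and columns are points of evaluation, so deleting, moving or
  replacing a row or a column is an operation on lists, free of index arithmetic.\<close>

definition dt :: "('c \<Rightarrow> real) list \<Rightarrow> 'c list \<Rightarrow> real" where
  "dt vs cs = det (mat (length vs) (length vs) (\<lambda>(i, j). (vs ! i) (cs ! j)))"

lemma dt_Nil [simp]: "dt [] [] = 1"
  by (simp add: dt_def)

text \<open>The cofactors along a row do not involve that row, so one vector \<open>K\<close> serves
  for every \<open>v\<close>. All linearity facts below are read off from it.\<close>

lemma dt_row_expansion:
  fixes cs :: "'c list"
  assumes "length cs = Suc (length pre + length post)"
  shows "\<exists>K. \<forall>v. dt (pre @ v # post) cs = (\<Sum>j<length cs. v (cs ! j) * K j)"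
proof -
  let ?n = "length cs" and ?k = "length pre"
  let ?M = "\<lambda>v. mat ?n ?n (\<lambda>(i, j). ((pre @ v # post) ! i) (cs ! j))"
  let ?K = "\<lambda>j. cofactor (?M (\<lambda>_. 0)) ?k j"
  have "dt (pre @ v # post) cs = (\<Sum>j<?n. v (cs ! j) * ?K j)" for v
  proof -
    have "dt (pre @ v # post) cs = det (?M v)"
      using assms by (simp add: dt_def)
    also have "\<dots> = (\<Sum>j<?n. ?M v $$ (?k, j) * cofactor (?M v) ?k j)"
      by (rule laplace_expansion_row) (use assms in auto)
    also have "\<dots> = (\<Sum>j<?n. v (cs ! j) * ?K j)"
    proof (rule sum.cong[OF refl])
      fix j assume j: "j \<in> {..<?n}"
      have "mat_delete (?M v) ?k j = mat_delete (?M (\<lambda>_. 0)) ?k j"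
        using assms by (intro eq_matI) (auto simp: mat_delete_def nth_append nth_Cons')
      then show "?M v $$ (?k, j) * cofactor (?M v) ?k j = v (cs ! j) * ?K j"
        using assms j by (simp add: cofactor_def)
    qed
    finally show ?thesis .
  qed
  then show ?thesis by blast
qed

lemma dt_row_sum:
  assumes "length cs = Suc (length pre + length post)"
  shows "dt (pre @ (\<lambda>c. \<Sum>t\<in>A. f t c) # post) cs = (\<Sum>t\<in>A. dt (pre @ f t # post) cs)"
proof -
  obtain K where K: "\<And>v. dt (pre @ v # post) cs = (\<Sum>j<length cs. v (cs ! j) * K j)"
    using dt_row_expansion[OF assms] by blast
  show ?thesis
    unfolding K by (subst sum.swap) (simp add: sum_distrib_right)
qed

lemma dt_row_linear:
  assumes "length cs = Suc (length pre + length post)"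
  shows "dt (pre @ (\<lambda>c. \<alpha> * u c + \<beta> * w c) # post) cs
    = \<alpha> * dt (pre @ u # post) cs + \<beta> * dt (pre @ w # post) cs"
proof -
  obtain K where K: "\<And>v. dt (pre @ v # post) cs = (\<Sum>j<length cs. v (cs ! j) * K j)"
    using dt_row_expansion[OF assms] by blast
  show ?thesis
    unfolding K by (simp add: sum_distrib_left sum.distrib[symmetric] algebra_simps)
qed

lemma dt_cong:
  assumes "length vs = length cs" "length vs = length ws"
    and "\<And>i c. i < length vs \<Longrightarrow> c \<in> set cs \<Longrightarrow> (vs ! i) c = (ws ! i) c"
  shows "dt vs cs = dt ws cs"
  unfolding dt_def using assms by (intro arg_cong[of _ _ det] eq_matI) auto

lemma dt_map_columns:
  assumes "length vs = length cs"
  shows "dt vs (map g cs) = dt (map (\<lambda>v c. v (g c)) vs) cs"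
  unfolding dt_def using assms by (intro arg_cong[of _ _ det] eq_matI) auto

lemma dt_identical_rows:
  assumes "length vs = length cs" "i < length vs" "j < length vs" "i \<noteq> j" "vs ! i = vs ! j"
  shows "dt vs cs = 0"
  unfolding dt_def
proof (rule det_identical_rows)
  show "row (mat (length vs) (length vs) (\<lambda>(i, j). (vs ! i) (cs ! j))) i
    = row (mat (length vs) (length vs) (\<lambda>(i, j). (vs ! i) (cs ! j))) j"
    using assms by (intro eq_vecI) auto
qed (use assms in auto)

lemma dt_identical_columns:
  assumes "length vs = length cs" "i < length vs" "j < length vs" "i \<noteq> j" "cs ! i = cs ! j"
  shows "dt vs cs = 0"
  unfolding dt_def
proof (rule det_identical_columns)
  show "col (mat (length vs) (length vs) (\<lambda>(i, j). (vs ! i) (cs ! j))) i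
    = col (mat (length vs) (length vs) (\<lambda>(i, j). (vs ! i) (cs ! j))) j"
    using assms by (intro eq_vecI) auto
qed (use assms in auto)

text \<open>Any row of \<open>pre\<close>, put in the place of \<open>v\<close>, gives two equal
  rows, so its sum against \<open>K\<close> is 0.\<close>

lemma dt_add_rows:
  assumes "length cs = Suc (length pre + length post)"
  shows "dt (pre @ (\<lambda>c. \<beta> * v c + (\<Sum>i<length pre. \<alpha> i * (pre ! i) c)) # post) cs
    = \<beta> * dt (pre @ v # post) cs"
proof -
  obtain K where K: "\<And>v. dt (pre @ v # post) cs = (\<Sum>j<length cs. v (cs ! j) * K j)"
    using dt_row_expansion[OF assms] by blast
  have zero: "(\<Sum>j<length cs. (pre ! i) (cs ! j) * K j) = 0" if "i < length pre" for i
    unfolding K[symmetric] using that assms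
    by (intro dt_identical_rows[of _ _ i "length pre"]) (auto simp: nth_append)
  have "(\<Sum>j<length cs. (\<Sum>i<length pre. \<alpha> i * (pre ! i) (cs ! j)) * K j)
    = (\<Sum>i<length pre. \<alpha> i * (\<Sum>j<length cs. (pre ! i) (cs ! j) * K j))"
    by (simp add: sum_distrib_left sum_distrib_right sum.swap[of _ "{..<length cs}"] mult.assoc)
  also have "\<dots> = 0" by (simp add: zero)
  finally show ?thesis
    unfolding K by (simp add: distrib_right sum.distrib sum_distrib_left mult.assoc)
qed

lemma dt_block:
  assumes "length vs = length cs" "length ws = length ds"
    and "\<And>w c. w \<in> set ws \<Longrightarrow> c \<in> set cs \<Longrightarrow> w c = 0"
  shows "dt (vs @ ws) (cs @ ds) = dt vs cs * dt ws ds"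
proof -
  let ?n = "length vs" and ?m = "length ws"
  let ?A = "mat ?n ?n (\<lambda>(i, j). (vs ! i) (cs ! j))"
  let ?B = "mat ?n ?m (\<lambda>(i, j). (vs ! i) (ds ! j))"
  let ?D = "mat ?m ?m (\<lambda>(i, j). (ws ! i) (ds ! j))"
  have "mat (length (vs @ ws)) (length (vs @ ws)) (\<lambda>(i, j). ((vs @ ws) ! i) ((cs @ ds) ! j))
    = four_block_mat ?A ?B (0\<^sub>m ?m ?n) ?D"
    using assms by (intro eq_matI) (auto simp: nth_append)
  then have "dt (vs @ ws) (cs @ ds) = det (four_block_mat ?A ?B (0\<^sub>m ?m ?n) ?D)"
    by (simp add: dt_def)
  also have "\<dots> = det ?A * det ?D"
    by (rule det_four_block_mat_lower_left_zero) auto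
  finally show ?thesis by (simp add: dt_def)
qed

lemma dt_single: "dt [v] [c] = v c"
  by (simp add: dt_def det_single)

lemma dt_Cons_block:
  assumes "length vs = length cs" "\<And>v. v \<in> set vs \<Longrightarrow> v c = 0"
  shows "dt (u # vs) (c # cs) = u c * dt vs cs"
  using dt_block[of "[u]" "[c]" vs cs] assms by (simp add: dt_single)

lemma dt_pair: "dt [u, v] [c, d] = u c * v d - u d * v c"
proof -
  let ?M = "mat 2 2 (\<lambda>(i, j). ([u, v] ! i) ([c, d] ! j))"
  have "dt [u, v] [c, d] = det ?M"
    by (simp add: dt_def numeral_2_eq_2)
  also have "\<dots> = (\<Sum>j<2. ?M $$ (0, j) * cofactor ?M 0 j)"
    by (rule laplace_expansion_row) auto
  also have "\<dots> = u c * cofactor ?M 0 0 + u d * cofactor ?M 0 1"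
    by (simp add: numeral_2_eq_2)
  also have "cofactor ?M 0 0 = v d"
    unfolding cofactor_def by (subst det_single) (auto simp: mat_delete_def)
  also have "cofactor ?M 0 1 = - v c"
    unfolding cofactor_def by (subst det_single) (auto simp: mat_delete_def)
  finally show ?thesis by simp
qed

lemma dt_permute_rows:
  assumes "mset vs = mset ws" "length vs = length cs"
  shows "\<bar>dt vs cs\<bar> = \<bar>dt ws cs\<bar>"
proof -
  obtain p where p: "p permutes {..<length ws}" "permute_list p ws = vs"
    using assms(1) mset_eq_permutation by metis
  let ?n = "length ws"
  let ?M = "mat ?n ?n (\<lambda>(i, j). (ws ! i) (cs ! j))"
  have n: "length vs = ?n" using p by auto
  have p': "p permutes {0..<?n}" using p by (simp add: atLeast0LessThan)
  have "mat ?n ?n (\<lambda>(i, j). (vs ! i) (cs ! j)) = mat ?n ?n (\<lambda>(i, j). ?M $$ (p i, j))"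
  proof (rule eq_matI)
    fix i j assume "i < dim_row (mat ?n ?n (\<lambda>(i, j). ?M $$ (p i, j)))"
      "j < dim_col (mat ?n ?n (\<lambda>(i, j). ?M $$ (p i, j)))"
    then have ij: "i < ?n" "j < ?n" by simp_all
    then have "p i < ?n" using permutes_in_image[OF p(1)] by simp
    moreover have "vs ! i = ws ! p i" using p ij by (metis permute_list_nth)
    ultimately show "mat ?n ?n (\<lambda>(i, j). (vs ! i) (cs ! j)) $$ (i, j)
      = mat ?n ?n (\<lambda>(i, j). ?M $$ (p i, j)) $$ (i, j)" using ij by simp
  qed simp_all
  then have "dt vs cs = signof p * dt ws cs"
    unfolding dt_def n using det_permute_rows[OF _ p', of ?M] by simp
  then show ?thesis by (simp add: abs_mult sign_def)
qed

text \<open>A column \<open>c\<close> becomes the row \<open>\<lambda>v. v c\<close>, that is,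
  evaluation at \<open>c\<close>. This turns facts about rows into facts about columns.\<close>

lemma dt_transpose:
  assumes "length vs = length cs"
  shows "dt vs cs = dt (map (\<lambda>c v. v c) cs) vs"
proof -
  have "mat (length vs) (length vs) (\<lambda>(i, j). (vs ! i) (cs ! j))
    = transpose_mat (mat (length cs) (length cs) (\<lambda>(i, j). ((map (\<lambda>c v. v c) cs) ! i) (vs ! j)))"
    using assms by (intro eq_matI) auto
  then show ?thesis
    unfolding dt_def by (subst det_transpose[symmetric, where n = "length cs"]) (auto simp: assms)
qed

lemma dt_permute_columns:
  assumes "mset cs = mset ds" "length vs = length cs"
  shows "\<bar>dt vs cs\<bar> = \<bar>dt vs ds\<bar>"
proof -
  have len: "length cs = length ds" using assms(1) by (metis size_mset)
  have "\<bar>dt (map (\<lambda>c v. v c) cs) vs\<bar> = \<bar>dt (map (\<lambda>c v. v c) ds) vs\<bar>"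
    using assms by (intro dt_permute_rows) simp_all
  moreover have "dt vs cs = dt (map (\<lambda>c v. v c) cs) vs" "dt vs ds = dt (map (\<lambda>c v. v c) ds) vs"
    using assms(2) len by (intro dt_transpose; simp)+
  ultimately show ?thesis by argo
qed

section \<open>Bordered determinants and condensation\<close>

text \<open>Expansion along the last column. As a function of \<open>c\<close>, the bordered
  determinant is a row that arises from \<open>u\<close> by scaling and adding rows of
  \<open>vs\<close>.\<close>

lemma dt_snoc_eq:
  assumes "length vs = length cs"
  shows "\<exists>\<alpha>. \<forall>c. dt (vs @ [u]) (cs @ [c]) = dt vs cs * u c + (\<Sum>i<length vs. \<alpha> i * (vs ! i) c)"
proof -
  let ?n = "length vs"
  let ?M = "\<lambda>c. mat (Suc ?n) (Suc ?n) (\<lambda>(i, j). ((vs @ [u]) ! i) ((cs @ [c]) ! j))"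
  have eq: "dt (vs @ [u]) (cs @ [c]) = (\<Sum>i<?n. (vs ! i) c * cofactor (?M c) i ?n)
     + u c * dt vs cs" for c
  proof -
    have "dt (vs @ [u]) (cs @ [c]) = det (?M c)" by (simp add: dt_def)
    also have "\<dots> = (\<Sum>i<Suc ?n. ?M c $$ (i, ?n) * cofactor (?M c) i ?n)"
      by (rule laplace_expansion_column) auto
    also have "\<dots> = (\<Sum>i<?n. ?M c $$ (i, ?n) * cofactor (?M c) i ?n) + u c * cofactor (?M c) ?n ?n"
      using assms by (simp add: nth_append)
    also have "cofactor (?M c) ?n ?n = dt vs cs"
    proof -
      have "mat_delete (?M c) ?n ?n = mat ?n ?n (\<lambda>(i, j). (vs ! i) (cs ! j))"
        using assms by (intro eq_matI) (auto simp: mat_delete_def nth_append)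
      then show ?thesis by (simp add: cofactor_def dt_def)
    qed
    also have "(\<Sum>i<?n. ?M c $$ (i, ?n) * cofactor (?M c) i ?n)
      = (\<Sum>i<?n. (vs ! i) c * cofactor (?M c) i ?n)"
      using assms by (intro sum.cong) (auto simp: nth_append)
    finally show ?thesis .
  qed
  \<comment> \<open>Only the deleted column mentions \<open>c\<close>, so these cofactors may be
    taken at any fixed point, here \<open>undefined\<close>.\<close>
  have indep: "cofactor (?M c) i ?n = cofactor (?M undefined) i ?n" if "i < ?n" for i c
  proof -
    have "mat_delete (?M c) i ?n = mat_delete (?M undefined) i ?n"
      using assms that by (intro eq_matI) (auto simp: mat_delete_def nth_append)
    then show ?thesis by (simp add: cofactor_def)
  qed
  let ?\<alpha> = "\<lambda>i. cofactor (?M undefined) i ?n"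
  show ?thesis
  proof (rule exI, rule allI)
    fix c
    have "(\<Sum>i<?n. (vs ! i) c * cofactor (?M c) i ?n) = (\<Sum>i<?n. ?\<alpha> i * (vs ! i) c)"
    proof (rule sum.cong[OF refl])
      fix i assume "i \<in> {..<?n}"
      then have "cofactor (?M c) i ?n = ?\<alpha> i" using indep by blast
      then show "(vs ! i) c * cofactor (?M c) i ?n = ?\<alpha> i * (vs ! i) c"
        by (simp only: mult.commute)
    qed
    then show "dt (vs @ [u]) (cs @ [c]) = dt vs cs * u c + (\<Sum>i<?n. ?\<alpha> i * (vs ! i) c)"
      by (simp only: eq add.commute mult.commute[of "u c"])
  qed
qed

text \<open>The bordered determinant \<open>U u\<close> vanishes on \<open>cs\<close>, where a
  column would occur twice. Replacing \<open>u\<close> and \<open>v\<close> by \<open>U u\<close>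
  and \<open>U v\<close> multiplies the large determinant by \<open>dt vs cs\<close> twice and
  leaves a block triangular matrix with a 2 by 2 corner. One factor \<open>dt vs cs\<close> is then
  cancelled on both sides, by \<open>nz\<close>.\<close>

lemma dt_condensation:
  assumes len: "length vs = length cs" and nz: "dt vs cs \<noteq> 0"
  shows "dt (vs @ [u, v]) (cs @ [c, d]) * dt vs cs
    = dt (vs @ [u]) (cs @ [c]) * dt (vs @ [v]) (cs @ [d])
      - dt (vs @ [u]) (cs @ [d]) * dt (vs @ [v]) (cs @ [c])"
proof -
  let ?D = "dt vs cs"
  define U where "U u c = dt (vs @ [u]) (cs @ [c])" for u c
  have U0: "U u c = 0" if c: "c \<in> set cs" for u c
  proof -
    obtain i where "i < length cs" "cs ! i = c" using c by (auto simp: in_set_conv_nth)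
    then show ?thesis
      unfolding U_def by (intro dt_identical_columns[of _ _ i "length cs"]) (auto simp: len nth_append)
  qed
  obtain \<alpha> where \<alpha>: "\<And>c. U u c = ?D * u c + (\<Sum>i<length vs. \<alpha> i * (vs ! i) c)"
    unfolding U_def using dt_snoc_eq[OF len, of u] by blast
  obtain \<beta> where \<beta>: "\<And>c. U v c = ?D * v c + (\<Sum>i<length vs. \<beta> i * (vs ! i) c)"
    unfolding U_def using dt_snoc_eq[OF len, of v] by blast
  have "dt (vs @ [U u, U v]) (cs @ [c, d]) = ?D * (U u c * U v d - U u d * U v c)"
    using dt_block[OF len, of "[U u, U v]" "[c, d]"] U0 by (auto simp: dt_pair)
  moreover have "dt (vs @ [U u, U v]) (cs @ [c, d]) = ?D * dt (vs @ [u, U v]) (cs @ [c, d])"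
  proof -
    have "U u = (\<lambda>c. ?D * u c + (\<Sum>i<length vs. \<alpha> i * (vs ! i) c))" using \<alpha> by blast
    then show ?thesis using dt_add_rows[of "cs @ [c, d]" vs "[U v]" ?D u \<alpha>] len by simp
  qed
  moreover have "dt (vs @ [u, U v]) (cs @ [c, d]) = ?D * dt (vs @ [u, v]) (cs @ [c, d])"
  proof -
    \<comment> \<open>The rows above now include \<open>u\<close>, which enters with coefficient
      0.\<close>
    let ?\<beta> = "\<lambda>i. if i < length vs then \<beta> i else 0"
    have "U v = (\<lambda>c. ?D * v c + (\<Sum>i<length (vs @ [u]). ?\<beta> i * ((vs @ [u]) ! i) c))"
      using \<beta> by (auto simp: nth_append)
    then show ?thesis using dt_add_rows[of "cs @ [c, d]" "vs @ [u]" "[]" ?D v ?\<beta>] len by simp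
  qed
  ultimately have "?D * (?D * dt (vs @ [u, v]) (cs @ [c, d])) = ?D * (U u c * U v d - U u d * U v c)"
    by simp
  then show ?thesis using nz unfolding U_def by (simp add: mult.commute)
qed

section \<open>Lozenge tilings of a row\<close>

abbreviation num_tilings :: "tri set \<Rightarrow> nat" where
  "num_tilings R \<equiv> card (lozenge_tilings R)"

lemma finite_lozenge_tilings: "finite R \<Longrightarrow> finite (lozenge_tilings R)"
  by (rule finite_subset[of _ "Pow (Pow R)"]) (auto simp: lozenge_tilings_def)

lemma adj_commute: "adj s t \<longleftrightarrow> adj t s"
  by (auto simp: adj_def abs_minus_commute)

lemma lozenge_tilings_empty: "lozenge_tilings {} = {{}}"
proof -
  have "L \<noteq> {}" if "is_lozenge L" for L using that by (auto simp: is_lozenge_def)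
  then show ?thesis by (auto simp: lozenge_tilings_def)
qed

lemma lozenge_tilings_insert:
  assumes "s \<in> R" "t \<in> R" "adj s t" "T \<in> lozenge_tilings (R - {s, t})"
  shows "insert {s, t} T \<in> lozenge_tilings R" "{s, t} \<notin> T"
proof -
  have T: "\<forall>L\<in>T. is_lozenge L" "pairwise disjnt T" "\<Union>T = R - {s, t}"
    using assms(4) by (auto simp: lozenge_tilings_def)
  then have "\<forall>L\<in>T. disjnt {s, t} L" by (auto simp: disjnt_def)
  then have "pairwise disjnt (insert {s, t} T)"
    using T(2) by (auto simp: pairwise_insert disjnt_sym)
  moreover have "is_lozenge {s, t}" using assms(3) unfolding is_lozenge_def by blast
  ultimately show "insert {s, t} T \<in> lozenge_tilings R"
    using T assms by (auto simp: lozenge_tilings_def)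
  show "{s, t} \<notin> T" using T(3) by auto
qed

lemma lozenge_tilings_remove:
  assumes "T \<in> lozenge_tilings R" "s \<in> R"
  obtains t T' where "t \<in> R" "adj s t" "T' \<in> lozenge_tilings (R - {s, t})" "T = insert {s, t} T'"
proof -
  have T: "\<forall>L\<in>T. is_lozenge L" "pairwise disjnt T" "\<Union>T = R"
    using assms by (auto simp: lozenge_tilings_def)
  then obtain L where L: "L \<in> T" "s \<in> L" using assms(2) by auto
  then obtain t where t: "adj s t" "L = {s, t}"
    using T(1) adj_commute unfolding is_lozenge_def by fastforce
  have "t \<in> R" using T(3) L t by auto
  moreover have "T - {L} \<in> lozenge_tilings (R - {s, t})"
  proof -
    have "disjnt K L" if "K \<in> T - {L}" for K
      using T(2) L(1) that by (auto simp: pairwise_def)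
    then have "\<Union>(T - {L}) = R - {s, t}"
      using T(3) t(2) by (auto simp: disjnt_def)
    then show ?thesis
      using T by (auto simp: lozenge_tilings_def pairwise_def)
  qed
  moreover have "T = insert {s, t} (T - {L})" using L t by auto
  ultimately show thesis using that t(1) by blast
qed

lemma num_tilings_split:
  assumes "finite R" "s \<in> R"
  shows "num_tilings R = (\<Sum>t\<in>{t\<in>R. adj s t}. num_tilings (R - {s, t}))"
proof -
  let ?A = "{t\<in>R. adj s t}"
  let ?F = "\<lambda>t. insert {s, t} ` lozenge_tilings (R - {s, t})"
  have eq: "lozenge_tilings R = (\<Union>t\<in>?A. ?F t)"
  proof (intro equalityI subsetI)
    fix T assume "T \<in> lozenge_tilings R"
    from lozenge_tilings_remove[OF this assms(2)] show "T \<in> (\<Union>t\<in>?A. ?F t)" by blast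
  next
    fix T assume "T \<in> (\<Union>t\<in>?A. ?F t)"
    then show "T \<in> lozenge_tilings R" using lozenge_tilings_insert(1)[OF assms(2)] by blast
  qed
  have "?F t \<inter> ?F t' = {}" if "t \<in> ?A" "t' \<in> ?A" "t \<noteq> t'" for t t'
  proof (rule ccontr)
    assume "?F t \<inter> ?F t' \<noteq> {}"
    then obtain T where T: "T \<in> ?F t" "T \<in> ?F t'" by blast
    have "T \<in> lozenge_tilings R" using T(1) that(1) eq by blast
    then have "pairwise disjnt T" by (simp add: lozenge_tilings_def)
    moreover have "{s, t} \<in> T" using T(1) by (rule imageE) simp
    moreover have "{s, t'} \<in> T" using T(2) by (rule imageE) simp
    moreover have "{s, t} \<noteq> {s, t'}" using that(3) by (simp add: doubleton_eq_iff)
    ultimately have "disjnt {s, t} {s, t'}" by (metis pairwiseD)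
    then show False by (simp add: disjnt_def)
  qed
  then have "num_tilings R = (\<Sum>t\<in>?A. card (?F t))"
    unfolding eq using assms(1)
    by (intro card_UN_disjoint) (auto intro!: finite_lozenge_tilings)
  also have "\<dots> = (\<Sum>t\<in>?A. num_tilings (R - {s, t}))"
  proof (rule sum.cong[OF refl], rule card_image, rule inj_onI)
    fix t T T'
    assume t: "t \<in> ?A" and T: "T \<in> lozenge_tilings (R - {s, t})" "T' \<in> lozenge_tilings (R - {s, t})"
      and eq': "insert {s, t} T = insert {s, t} T'"
    have "t \<in> R" "adj s t" using t by simp_all
    then have "{s, t} \<notin> T" "{s, t} \<notin> T'"
      using T lozenge_tilings_insert(2)[OF assms(2)] by simp_all
    then show "T = T'" using eq' by (simp add: insert_ident)
  qed
  finally show ?thesis .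
qed

lemma adj_down:
  assumes "odd (r + c)" "adj (r, c) t"
  shows "t = (r, c - 1) \<or> t = (r, c + 1) \<or> t = (r - 1, c)"
  using assms by (cases t) (auto simp: adj_def is_up_def abs_if split: if_splits)

lemma adj_up:
  assumes "even (r + c)" "adj (r, c) t"
  shows "t = (r, c - 1) \<or> t = (r, c + 1) \<or> t = (r + 1, c)"
  using assms by (cases t) (auto simp: adj_def is_up_def abs_if split: if_splits)

lemma adj_simps [simp]:
  "adj (r, c) (r, c + 1)" "adj (r, c) (r, c - 1)" "even (r + c) \<Longrightarrow> adj (r, c) (r + 1, c)"
  by (auto simp: adj_def is_up_def)

lemma num_tilings_forced:
  assumes "finite R" "s \<in> R" "t \<in> R" "adj s t" "\<And>u. u \<in> R \<Longrightarrow> adj s u \<Longrightarrow> u = t"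
  shows "num_tilings R = num_tilings (R - {s, t})"
proof -
  have "{u\<in>R. adj s u} = {t}" using assms by blast
  then show ?thesis using num_tilings_split[OF assms(1,2)] by simp
qed

section \<open>Forced lozenges and stretches of the top row\<close>

text \<open>A down-pointing triangle has neighbours only to the left, to the right and above. With
  nothing above and nothing to the left it must take its right neighbour, which puts the next
  down-pointing triangle in the same situation.\<close>

lemma num_tilings_forced_left:
  assumes "finite R" "\<And>c'. (r - 1, c') \<notin> R" "odd (r + c)" "(r, c - 1) \<notin> R"
    and "{r} \<times> {c..<c + 2 * int n} \<subseteq> R"
  shows "num_tilings R = num_tilings (R - {r} \<times> {c..<c + 2 * int n})"
  using assms
proof (induction n arbitrary: R c)
  case (Suc n)
  have in_R: "(r, c) \<in> R" "(r, c + 1) \<in> R" using Suc.prems(5) by auto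
  have "num_tilings R = num_tilings (R - {(r, c), (r, c + 1)})"
  proof (rule num_tilings_forced[OF Suc.prems(1) in_R])
    fix u assume "u \<in> R" "adj (r, c) u"
    then show "u = (r, c + 1)" using adj_down[OF Suc.prems(3)] Suc.prems(2,4) by blast
  qed simp
  also have "\<dots> = num_tilings (R - {(r, c), (r, c + 1)} - {r} \<times> {c + 2..<c + 2 + 2 * int n})"
  proof (rule Suc.IH)
    have "(r, d) \<in> R" if "c + 2 \<le> d" "d < c + 2 + 2 * int n" for d
      using Suc.prems(5) that by auto
    then show "{r} \<times> {c + 2..<c + 2 + 2 * int n} \<subseteq> R - {(r, c), (r, c + 1)}" by auto
  qed (use Suc.prems in auto)
  also have "R - {(r, c), (r, c + 1)} - {r} \<times> {c + 2..<c + 2 + 2 * int n}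
    = R - {r} \<times> {c..<c + 2 * int (Suc n)}"
    by auto
  finally show ?case .
qed simp

lemma num_tilings_forced_right:
  assumes "finite R" "\<And>c'. (r - 1, c') \<notin> R" "odd (r + c)" "(r, c + 1) \<notin> R"
    and "{r} \<times> {c - 2 * int n<..c} \<subseteq> R"
  shows "num_tilings R = num_tilings (R - {r} \<times> {c - 2 * int n<..c})"
  using assms
proof (induction n arbitrary: R c)
  case (Suc n)
  have in_R: "(r, c) \<in> R" "(r, c - 1) \<in> R" using Suc.prems(5) by auto
  have "num_tilings R = num_tilings (R - {(r, c), (r, c - 1)})"
  proof (rule num_tilings_forced[OF Suc.prems(1) in_R])
    fix u assume "u \<in> R" "adj (r, c) u"
    then show "u = (r, c - 1)" using adj_down[OF Suc.prems(3)] Suc.prems(2,4) by blast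
  qed simp
  also have "\<dots> = num_tilings (R - {(r, c), (r, c - 1)} - {r} \<times> {c - 2 - 2 * int n<..c - 2})"
  proof (rule Suc.IH)
    have "(r, d) \<in> R" if "c - 2 - 2 * int n < d" "d \<le> c - 2" for d
      using Suc.prems(5) that by auto
    then show "{r} \<times> {c - 2 - 2 * int n<..c - 2} \<subseteq> R - {(r, c), (r, c - 1)}" by auto
  qed (use Suc.prems in auto)
  also have "R - {(r, c), (r, c - 1)} - {r} \<times> {c - 2 - 2 * int n<..c - 2}
    = R - {r} \<times> {c - 2 * int (Suc n)<..c}"
    by auto
  finally show ?case .
qed simp

text \<open>A stretch that begins and ends with up-pointing triangles has one more of these than
  down-pointing ones. So exactly one of them, at \<open>t\<close>, is joined with the row below, and
  the triangles on both sides of it are forced.\<close>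

lemma num_tilings_segment:
  assumes "finite R" "\<And>c'. (r - 1, c') \<notin> R" "even (r + c)" "(r, c - 1) \<notin> R"
    and "(r, c + 2 * int n + 1) \<notin> R" "{r} \<times> {c..c + 2 * int n} \<subseteq> R"
    and "\<And>t. t \<in> {c..c + 2 * int n} \<Longrightarrow> (r + 1, t) \<in> R"
  shows "num_tilings R = (\<Sum>t\<in>{t\<in>{c..c + 2 * int n}. even (r + t)}.
    num_tilings (R - {r} \<times> {c..c + 2 * int n} - {(r + 1, t)}))"
  using assms
proof (induction n arbitrary: R c)
  case 0
  have in_R: "(r, c) \<in> R" "(r + 1, c) \<in> R" using "0.prems"(6,7) by auto
  have right: "(r, c + 1) \<notin> R" using "0.prems"(5) by simp
  have "num_tilings R = num_tilings (R - {(r, c), (r + 1, c)})"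
  proof (rule num_tilings_forced[OF "0.prems"(1) in_R])
    fix u assume "u \<in> R" "adj (r, c) u"
    then show "u = (r + 1, c)" using adj_up[OF "0.prems"(3)] "0.prems"(4) right by blast
  qed (rule adj_simps(3)[OF "0.prems"(3)])
  moreover have "{t\<in>{c..c + 2 * int 0}. even (r + t)} = {c}" using "0.prems"(3) by auto
  moreover have "R - {(r, c), (r + 1, c)} = R - {r} \<times> {c..c + 2 * int 0} - {(r + 1, c)}" by auto
  ultimately show ?case by (simp only: sum.insert_remove sum.empty finite.emptyI) simp
next
  case (Suc n)
  let ?seg = "{r} \<times> {c..c + 2 * int (Suc n)}"
  have row: "(r, d) \<in> R" if "c \<le> d" "d \<le> c + 2 * int (Suc n)" for d
    using Suc.prems(6) that by auto
  have in_R: "(r, c) \<in> R" "(r, c + 1) \<in> R" "(r + 1, c) \<in> R"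
    using row[of c] row[of "c + 1"] Suc.prems(7)[of c] by auto
  have nbrs: "{t\<in>R. adj (r, c) t} = {(r, c + 1), (r + 1, c)}"
    using in_R Suc.prems(3,4) adj_up[OF Suc.prems(3)] adj_simps by blast
  have "num_tilings R = num_tilings (R - {(r, c), (r, c + 1)}) + num_tilings (R - {(r, c), (r + 1, c)})"
    using num_tilings_split[OF Suc.prems(1) in_R(1)] unfolding nbrs by simp
  \<comment> \<open>Once \<open>c\<close> is joined with the row below, the rest begins with a
    down-pointing triangle that has no left neighbour.\<close>
  also have "num_tilings (R - {(r, c), (r + 1, c)})
    = num_tilings (R - {(r, c), (r + 1, c)} - {r} \<times> {c + 1..<c + 1 + 2 * int (Suc n)})"
    by (rule num_tilings_forced_left) (use Suc.prems row in auto)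
  also have "R - {(r, c), (r + 1, c)} - {r} \<times> {c + 1..<c + 1 + 2 * int (Suc n)}
    = R - ?seg - {(r + 1, c)}"
    by auto
  also have "num_tilings (R - {(r, c), (r, c + 1)})
    = (\<Sum>t\<in>{t\<in>{c + 2..c + 2 + 2 * int n}. even (r + t)}.
        num_tilings (R - {(r, c), (r, c + 1)} - {r} \<times> {c + 2..c + 2 + 2 * int n} - {(r + 1, t)}))"
    by (rule Suc.IH) (use Suc.prems row in \<open>auto simp: algebra_simps\<close>)
  also have "\<dots> = (\<Sum>t\<in>{t\<in>{c + 2..c + 2 + 2 * int n}. even (r + t)}. num_tilings (R - ?seg - {(r + 1, t)}))"
  proof (rule sum.cong[OF refl])
    fix t
    have "R - {(r, c), (r, c + 1)} - {r} \<times> {c + 2..c + 2 + 2 * int n} = R - ?seg" by auto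
    then show "num_tilings (R - {(r, c), (r, c + 1)} - {r} \<times> {c + 2..c + 2 + 2 * int n} - {(r + 1, t)})
      = num_tilings (R - ?seg - {(r + 1, t)})" by simp
  qed
  also have "\<dots> + num_tilings (R - ?seg - {(r + 1, c)})
    = (\<Sum>t\<in>insert c {t\<in>{c + 2..c + 2 + 2 * int n}. even (r + t)}. num_tilings (R - ?seg - {(r + 1, t)}))"
    by (subst sum.insert) (auto intro: finite_subset[of _ "{c + 2..c + 2 + 2 * int n}"])
  also have "insert c {t\<in>{c + 2..c + 2 + 2 * int n}. even (r + t)}
    = {t\<in>{c..c + 2 * int (Suc n)}. even (r + t)}"
  proof -
    have "t \<ge> c + 2" if "t \<ge> c" "t \<noteq> c" "even (r + t)" for t
      using that Suc.prems(3) by presburger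
    then show ?thesis using Suc.prems(3) by auto
  qed
  finally show ?case .
qed

lemma even_nonneg_int:
  assumes "even (d :: int)" "0 \<le> d"
  obtains n where "d = 2 * int n"
proof -
  obtain k where "d = 2 * k" using assms(1) by (rule evenE)
  then show thesis using assms(2) that[of "nat k"] by simp
qed

section \<open>Interlacing positions in consecutive rows\<close>

text \<open>One set for each entry of \<open>S\<close>: the up-pointing positions between its
  predecessor (at first \<open>c\<close>) and that entry. Thus \<open>listset\<close> of this list
  consists of the sequences that interlace with \<open>S\<close>.\<close>

fun gaps :: "int \<Rightarrow> int \<Rightarrow> int list \<Rightarrow> int set list" where
  "gaps r c [] = []"
| "gaps r c (s # S) = {t\<in>{c..<s}. even (r + t)} # gaps r (s + 1) S"

lemma length_gaps [simp]: "length (gaps r c S) = length S"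
  by (induction S arbitrary: c) auto

lemma gaps_finite: "A \<in> set (gaps r c S) \<Longrightarrow> finite A"
  by (induction S arbitrary: c) (auto intro: finite_subset[of _ "{_..<_}"])

lemma sum_listset_Cons:
  assumes "finite A"
  shows "(\<Sum>T\<in>listset (A # As). g T) = (\<Sum>t\<in>A. \<Sum>T\<in>listset As. g (t # T))"
proof -
  have "(\<Sum>T\<in>listset (A # As). g T) = (\<Sum>(t, T)\<in>A \<times> listset As. g (t # T))"
    by (rule sum.reindex_bij_witness[of _ "\<lambda>(t, T). t # T" "\<lambda>T. (hd T, tl T)"])
      (auto simp: set_Cons_def)
  then show ?thesis by (simp add: sum.cartesian_product)
qed

lemma listset_gaps:
  assumes "T \<in> listset (gaps r c S)" "\<forall>s\<in>set S. c \<le> s" "sorted_wrt (<) S"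
  shows "sorted_wrt (<) T \<and> length T = length S
    \<and> (\<forall>t\<in>set T. c \<le> t \<and> even (r + t) \<and> (\<exists>s\<in>set S. t < s))"
  using assms
proof (induction S arbitrary: c T)
  case (Cons s S)
  obtain t T' where T: "T = t # T'" "c \<le> t" "t < s" "even (r + t)" "T' \<in> listset (gaps r (s + 1) S)"
    using Cons.prems(1) by (auto simp: set_Cons_def)
  have "sorted_wrt (<) T' \<and> length T' = length S
    \<and> (\<forall>t\<in>set T'. s + 1 \<le> t \<and> even (r + t) \<and> (\<exists>s\<in>set S. t < s))"
    using Cons.prems(3) by (intro Cons.IH[OF T(5)]) auto
  then show ?case using T Cons.prems(2) by fastforce
qed simp

text \<open>The positions in \<open>S\<close> are down-pointing triangles already covered from
  above. They cut the row into stretches that begin and end with up-pointing triangles, and each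
  stretch sends exactly one lozenge into the next row.\<close>

lemma num_tilings_row:
  assumes "finite R" "\<And>c'. (r - 1, c') \<notin> R" "even (r + c)" "(r, c - 1) \<notin> R"
    and "sorted_wrt (<) S" "\<And>s. s \<in> set S \<Longrightarrow> c \<le> s \<and> odd (r + s) \<and> (r, s) \<notin> R"
    and "\<And>s c'. s \<in> set S \<Longrightarrow> c \<le> c' \<Longrightarrow> c' < s \<Longrightarrow> c' \<notin> set S \<Longrightarrow> (r, c') \<in> R \<and> (r + 1, c') \<in> R"
  shows "num_tilings R = (\<Sum>T\<in>listset (gaps r c S).
    num_tilings (R - {(r, c') | c'. c \<le> c' \<and> (\<exists>s\<in>set S. c' < s)} - Pair (r + 1) ` set T))"
  using assms
proof (induction S arbitrary: R c)
  case (Cons s S)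
  let ?seg = "{r} \<times> {c..<s}"
  let ?A = "{t\<in>{c..<s}. even (r + t)}"
  have s: "c \<le> s" "odd (r + s)" "(r, s) \<notin> R" using Cons.prems(6) by auto
  have S: "sorted_wrt (<) S" "\<And>s'. s' \<in> set S \<Longrightarrow> s < s'" using Cons.prems(5) by auto
  obtain n where n: "s = c + 2 * int n + 1"
  proof -
    have "even (s - c - 1)" "s - c - 1 \<ge> 0" using s(1,2) Cons.prems(3) by presburger+
    then obtain n where "s - c - 1 = 2 * int n" by (rule even_nonneg_int)
    then show thesis using that[of n] by simp
  qed
  have interval: "{c..c + 2 * int n} = {c..<s}" using n by auto
  have fin: "finite ?A" by (rule finite_subset[of _ "{c..<s}"]) auto
  have below: "(r, c') \<in> R \<and> (r + 1, c') \<in> R" if "c \<le> c'" "c' < s" for c'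
    using Cons.prems(7)[of s c'] that S(2) by force
  have "num_tilings R = (\<Sum>t\<in>?A. num_tilings (R - ?seg - {(r + 1, t)}))"
    unfolding interval[symmetric]
  proof (rule num_tilings_segment)
    show "(r, c + 2 * int n + 1) \<notin> R" using s(3) n by simp
    show "{r} \<times> {c..c + 2 * int n} \<subseteq> R" using below n by auto
    show "(r + 1, t) \<in> R" if "t \<in> {c..c + 2 * int n}" for t
      using below that n by simp
  qed (use Cons.prems in simp_all)
  also have "\<dots> = (\<Sum>t\<in>?A. \<Sum>T\<in>listset (gaps r (s + 1) S).
    num_tilings (R - {(r, c') | c'. c \<le> c' \<and> (\<exists>s\<in>set (s # S). c' < s)} - Pair (r + 1) ` set (t # T)))"
  proof (rule sum.cong[OF refl])
    fix t assume t: "t \<in> ?A"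
    let ?R = "R - ?seg - {(r + 1, t)}"
    have "num_tilings ?R = (\<Sum>T\<in>listset (gaps r (s + 1) S).
      num_tilings (?R - {(r, c') | c'. s + 1 \<le> c' \<and> (\<exists>s\<in>set S. c' < s)} - Pair (r + 1) ` set T))"
    proof (rule Cons.IH)
      show "s + 1 \<le> s' \<and> odd (r + s') \<and> (r, s') \<notin> ?R" if "s' \<in> set S" for s'
        using Cons.prems(6)[of s'] S(2)[OF that] that by simp
      show "(r, c') \<in> ?R \<and> (r + 1, c') \<in> ?R"
        if "s' \<in> set S" "s + 1 \<le> c'" "c' < s'" "c' \<notin> set S" for s' c'
        using Cons.prems(7)[of s' c'] that t s(1) by auto
      show "even (r + (s + 1))" using s(2) by presburger
    qed (use Cons.prems(1,2) s(3) S(1) in simp_all)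
    also have "\<dots> = (\<Sum>T\<in>listset (gaps r (s + 1) S).
      num_tilings (R - {(r, c') | c'. c \<le> c' \<and> (\<exists>s\<in>set (s # S). c' < s)} - Pair (r + 1) ` set (t # T)))"
    proof (rule sum.cong[OF refl])
      fix T
      have "?R - {(r, c') | c'. s + 1 \<le> c' \<and> (\<exists>s\<in>set S. c' < s)} - Pair (r + 1) ` set T
        = R - {(r, c') | c'. c \<le> c' \<and> (\<exists>s\<in>set (s # S). c' < s)} - Pair (r + 1) ` set (t # T)"
      proof (rule Set.set_eqI)
        fix u :: tri
        obtain a b where u: "u = (a, b)" by force
        have "b < s \<or> b = s \<or> s + 1 \<le> b" by linarith
        then show "u \<in> ?R - {(r, c') | c'. s + 1 \<le> c' \<and> (\<exists>s\<in>set S. c' < s)} - Pair (r + 1) ` set T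
          \<longleftrightarrow> u \<in> R - {(r, c') | c'. c \<le> c' \<and> (\<exists>s\<in>set (s # S). c' < s)} - Pair (r + 1) ` set (t # T)"
          unfolding u using s(1,3) S(2) by (cases "a = r") (auto 0 3)
      qed
      then show "num_tilings (?R - {(r, c') | c'. s + 1 \<le> c' \<and> (\<exists>s\<in>set S. c' < s)} - Pair (r + 1) ` set T)
        = num_tilings (R - {(r, c') | c'. c \<le> c' \<and> (\<exists>s\<in>set (s # S). c' < s)} - Pair (r + 1) ` set (t # T))"
        by simp
    qed
    finally show "num_tilings ?R = \<dots>" .
  qed
  also have "\<dots> = (\<Sum>T\<in>listset (gaps r c (s # S)).
    num_tilings (R - {(r, c') | c'. c \<le> c' \<and> (\<exists>s\<in>set (s # S). c' < s)} - Pair (r + 1) ` set T))"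
    unfolding gaps.simps sum_listset_Cons[OF fin] ..
  finally show ?case .
qed simp

section \<open>Transfer of determinants between rows\<close>

text \<open>Each entry of \<open>T\<close> affects a single row, so by multilinearity the sum over a
  product of sets moves into the rows. Here a sum over interlacing sequences becomes one
  determinant.\<close>

lemma sum_dt_listset:
  assumes "length cs = length pre + length As + length post" "\<And>A. A \<in> set As \<Longrightarrow> finite A"
  shows "(\<Sum>T\<in>listset As. dt (pre @ map f T @ post) cs)
    = dt (pre @ map (\<lambda>A c. \<Sum>t\<in>A. f t c) As @ post) cs"
  using assms
proof (induction As arbitrary: pre)
  case (Cons A As)
  have "(\<Sum>T\<in>listset (A # As). dt (pre @ map f T @ post) cs)
    = (\<Sum>t\<in>A. \<Sum>T\<in>listset As. dt ((pre @ [f t]) @ map f T @ post) cs)"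
    using Cons.prems(2) by (subst sum_listset_Cons) auto
  also have "\<dots> = (\<Sum>t\<in>A. dt (pre @ f t # map (\<lambda>A c. \<Sum>t\<in>A. f t c) As @ post) cs)"
  proof (rule sum.cong[OF refl])
    fix t
    show "(\<Sum>T\<in>listset As. dt ((pre @ [f t]) @ map f T @ post) cs)
      = dt (pre @ f t # map (\<lambda>A c. \<Sum>t\<in>A. f t c) As @ post) cs"
      using Cons.prems by (subst Cons.IH) auto
  qed
  also have "\<dots> = dt (pre @ (\<lambda>c. \<Sum>t\<in>A. f t c) # map (\<lambda>A c. \<Sum>t\<in>A. f t c) As @ post) cs"
    using Cons.prems(1) by (subst dt_row_sum) auto
  finally show ?case by simp
qed simp

section \<open>From sums over gaps back to path counts\<close>

fun diffs :: "('c \<Rightarrow> real) \<Rightarrow> ('c \<Rightarrow> real) list \<Rightarrow> ('c \<Rightarrow> real) list" where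
  "diffs u [] = []"
| "diffs u (v # vs) = (\<lambda>c. v c - u c) # diffs v vs"

lemma length_diffs [simp]: "length (diffs u vs) = length vs"
  by (induction vs arbitrary: u) auto

text \<open>Sums over gaps telescope into differences of consecutive rows. The determinant does not
  notice such differences, so the rows belonging to the old positions come back.\<close>

lemma dt_diffs:
  assumes "length cs = Suc (length pre + length vs + length post)"
  shows "dt (pre @ u # diffs u vs @ post) cs = dt (pre @ u # vs @ post) cs"
  using assms
proof (induction vs arbitrary: u pre)
  case (Cons v vs)
  have "dt (pre @ u # diffs u (v # vs) @ post) cs
    = dt ((pre @ [u]) @ (\<lambda>c. 1 * v c + (-1) * u c) # diffs v vs @ post) cs"
    by simp
  also have "\<dots> = dt ((pre @ [u]) @ v # diffs v vs @ post) cs - dt ((pre @ [u]) @ u # diffs v vs @ post) cs"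
    using Cons.prems by (subst dt_row_linear) auto
  also have "dt ((pre @ [u]) @ u # diffs v vs @ post) cs = 0"
    by (rule dt_identical_rows[of _ _ "length pre" "Suc (length pre)"])
      (use Cons.prems in \<open>auto simp: nth_append\<close>)
  also have "dt ((pre @ [u]) @ v # diffs v vs @ post) cs = dt ((pre @ [u]) @ v # vs @ post) cs"
    using Cons.prems by (intro Cons.IH) auto
  finally show ?case by simp
qed simp

text \<open>The number of ways in which the path entering the down-pointing triangle \<open>(r, s)\<close> from above
  reaches the exit in row \<open>e\<close>, where \<open>s\<close> may also be the starting position just outside the
  right boundary.\<close>

definition paths :: "nat \<Rightarrow> int \<Rightarrow> nat \<Rightarrow> real" where
  "paths r s e = (if r \<le> e then of_nat (nat ((s - 1 + int (e mod 2) + int e - int r) div 2) choose (e - r)) else 0)"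

lemma paths_self [simp]: "paths r s r = 1"
  by (simp add: paths_def)

lemma paths_less [simp]: "e < r \<Longrightarrow> paths r s e = 0"
  by (simp add: paths_def)

text \<open>Pascal's rule. The bound \<open>s \<ge> -1\<close> ensures that \<open>nat\<close>
  truncates nothing.\<close>

lemma paths_step:
  assumes "s \<ge> -1" "odd (int r + s)"
  shows "paths r (s + 2) e = paths r s e + paths (Suc r) (s + 1) e"
proof (cases "r < e")
  case True
  then obtain k where k: "e = r + Suc k" using less_imp_Suc_add by auto
  define n where "n = nat ((s - 1 + int (e mod 2) + int e - int r) div 2)"
  \<comment> \<open>The critical case is \<open>s = -1\<close>, \<open>e = r + 1\<close>: then
    \<open>r\<close> is even and \<open>e\<close> is odd, and the summand \<open>e mod 2\<close>
    brings the value up to 0.\<close>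
  have "s - 1 + int (e mod 2) + int e - int r \<ge> 0"
  proof (cases "s = -1")
    case True
    then have "even r" using assms(2) by presburger
    then have "int (e mod 2) + int e - int r \<ge> 2" using \<open>r < e\<close> by presburger
    then show ?thesis using True by simp
  qed (use assms(1) True in auto)
  moreover have "(s + 2 - 1 + int (e mod 2) + int e - int r) div 2
    = (s - 1 + int (e mod 2) + int e - int r) div 2 + 1"
    by simp
  ultimately have "nat ((s + 2 - 1 + int (e mod 2) + int e - int r) div 2) = Suc n"
    unfolding n_def by (simp add: Suc_nat_eq_nat_zadd1 add.commute)
  moreover have "nat ((s + 1 - 1 + int (e mod 2) + int e - int (Suc r)) div 2) = n"
    unfolding n_def by (simp add: algebra_simps)
  ultimately show ?thesis
    using k by (simp add: paths_def n_def[symmetric])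
qed (cases "r = e"; simp add: paths_def)

text \<open>The position -1 is a virtual one just left of an even row. Its counts vanish because the
  upper index of the binomial coefficient is below the lower one.\<close>

lemma paths_start:
  assumes "even r" "r < e"
  shows "paths r (-1) e = 0"
proof -
  have "(- 2 + int (e mod 2) + int e - int r) div 2 < int e - int r"
    using assms(2) by simp
  then have "nat ((- 2 + int (e mod 2) + int e - int r) div 2) < e - r"
    using assms(2) by linarith
  then show ?thesis using assms by (simp add: paths_def binomial_eq_0)
qed

text \<open>The summands telescope by \<open>paths_step\<close>.\<close>

lemma sum_paths_gap:
  assumes "s \<ge> -1" "odd (int r + s)"
  shows "(\<Sum>t\<in>{t\<in>{s + 1..<s + 2 * int n}. even (int r + t)}. paths (Suc r) t e)
    = paths r (s + 2 * int n) e - paths r s e"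
proof (induction n)
  case (Suc n)
  let ?A = "{t\<in>{s + 1..<s + 2 * int n}. even (int r + t)}"
  have "{t\<in>{s + 1..<s + 2 * int (Suc n)}. even (int r + t)} = insert (s + 2 * int n + 1) ?A"
  proof -
    have "t < s + 2 * int n \<or> t = s + 2 * int n + 1" if "t < s + 2 * int (Suc n)" "even (int r + t)" for t
      using that assms(2) by presburger
    then show ?thesis using assms(2) by auto
  qed
  moreover have "finite ?A" by (rule finite_subset[of _ "{s + 1..<s + 2 * int n}"]) auto
  ultimately show ?case
    using Suc paths_step[of "s + 2 * int n" r e] assms by (simp add: algebra_simps)
qed simp

lemma map_sum_gaps:
  assumes "s \<ge> -1" "odd (int r + s)" "sorted_wrt (<) (s # S)" "\<forall>t\<in>set S. odd (int r + t)"
  shows "map (\<lambda>A e. \<Sum>t\<in>A. paths (Suc r) t e) (gaps (int r) (s + 1) S)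
    = diffs (paths r s) (map (paths r) S)"
  using assms
proof (induction S arbitrary: s)
  case (Cons t S)
  have t: "s < t" "odd (int r + t)" using Cons.prems by auto
  then have "even (t - s)" "t - s \<ge> 0" using Cons.prems(2) by presburger+
  then obtain n where "t - s = 2 * int n" by (rule even_nonneg_int)
  then have n: "t = s + 2 * int n" by simp
  have "(\<lambda>e. \<Sum>t\<in>{u\<in>{s + 1..<t}. even (int r + u)}. paths (Suc r) t e)
    = (\<lambda>e. paths r t e - paths r s e)"
    unfolding n using sum_paths_gap[OF Cons.prems(1,2)] by (intro ext) blast
  moreover have "map (\<lambda>A e. \<Sum>t\<in>A. paths (Suc r) t e) (gaps (int r) (t + 1) S)
    = diffs (paths r t) (map (paths r) S)"
    using Cons.prems t by (intro Cons.IH) auto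
  ultimately show ?case by simp
qed simp

section \<open>Removing a whole top row\<close>

lemma sorted_wrt_le_last:
  fixes S :: "int list"
  assumes "sorted_wrt (<) S" "s \<in> set S"
  shows "s \<le> last S"
  using assms by (induction S) (auto dest!: bspec[OF _ last_in_set] intro: less_imp_le)

text \<open>To the right of the last entry of \<open>S\<close> the triangles pair up, forced from
  the right end. The condition \<open>tail\<close> admits a row that ends with a down-pointing
  triangle, a row where a path starts at the virtual position \<open>w + 1\<close>, and an empty
  row.\<close>

lemma num_tilings_row_up:
  assumes fin: "finite R" and above: "\<And>c. (r - 1, c) \<notin> R" and l: "even (r + l)"
    and row: "\<And>c. (r, c) \<in> R \<longleftrightarrow> l \<le> c \<and> c \<le> w \<and> c \<notin> set S"
    and sorted: "sorted_wrt (<) S" and S: "\<And>s. s \<in> set S \<Longrightarrow> l \<le> s \<and> s \<le> w + 1 \<and> odd (r + s)"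
    and below: "\<And>s c. s \<in> set S \<Longrightarrow> l \<le> c \<Longrightarrow> c < s \<Longrightarrow> (r + 1, c) \<in> R"
    and tail: "odd (r + w) \<or> w + 1 \<in> set S \<or> w < l"
  shows "num_tilings R = (\<Sum>T\<in>listset (gaps r l S). num_tilings (R - {r} \<times> UNIV - Pair (r + 1) ` set T))"
proof -
  \<comment> \<open>The default \<open>l - 1\<close> lies just left of the row: without any entry in
    \<open>S\<close> the whole row is forced.\<close>
  define b where "b = (if S = [] then l - 1 else last S)"
  have b: "l - 1 \<le> b" "odd (r + b)" using S[of "last S"] l by (auto simp: b_def)
  have S_le: "s \<le> b" if "s \<in> set S" for s
    using sorted_wrt_le_last[OF sorted that] that by (auto simp: b_def)
  let ?R = "R - {r} \<times> {b<..w}"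
  have "num_tilings R = num_tilings ?R"
  proof (cases "b < w")
    case True
    then have odd_w: "odd (r + w)" using tail S_le b(1) by force
    then have "even (w - b)" "0 \<le> w - b" using b(2) True by presburger+
    then obtain n where n: "w - b = 2 * int n" by (rule even_nonneg_int)
    then have "num_tilings R = num_tilings (R - {r} \<times> {w - 2 * int n<..w})"
      using fin above odd_w row b(1) S_le by (intro num_tilings_forced_right) force+
    then show ?thesis using n by (metis diff_diff_eq2 diff_add_cancel add_diff_cancel_left')
  qed simp
  also have "\<dots> = (\<Sum>T\<in>listset (gaps r l S).
      num_tilings (?R - {(r, c') | c'. l \<le> c' \<and> (\<exists>s\<in>set S. c' < s)} - Pair (r + 1) ` set T))"
  proof (rule num_tilings_row)
    show "(r, c') \<in> ?R \<and> (r + 1, c') \<in> ?R"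
      if "s \<in> set S" "l \<le> c'" "c' < s" "c' \<notin> set S" for s c'
      using that row S[of s] below S_le[of s] by force
  qed (use fin above l row sorted S in auto)
  also have "\<dots> = (\<Sum>T\<in>listset (gaps r l S). num_tilings (R - {r} \<times> UNIV - Pair (r + 1) ` set T))"
  proof -
    have "?R - {(r, c') | c'. l \<le> c' \<and> (\<exists>s\<in>set S. c' < s)} = R - {r} \<times> UNIV"
    proof -
      have cover: "b < c \<or> (\<exists>s\<in>set S. c < s)" if "(r, c) \<in> R" for c
      proof (cases "S = []")
        case True
        then show ?thesis using that row by (auto simp: b_def)
      next
        case False
        then have "b \<in> set S" by (auto simp: b_def)
        then show ?thesis using that row by (metis linorder_less_linear)
      qed
      have "\<forall>c. (r, c) \<in> R \<longrightarrow> l \<le> c \<and> c \<le> w \<and> (b < c \<or> (\<exists>s\<in>set S. c < s))"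
        using row cover by blast
      then show ?thesis by auto
    qed
    then show ?thesis by simp
  qed
  finally show ?thesis .
qed

text \<open>A row that begins with a down-pointing triangle is forced up to the first covered
  position \<open>s\<close>. So the path at \<open>s\<close> leaves the region in this row, and only
  the gaps after \<open>s\<close> send a lozenge downwards.\<close>

lemma num_tilings_row_down:
  assumes fin: "finite R" and above: "\<And>c. (r - 1, c) \<notin> R" and l: "odd (r + l)"
    and row: "\<And>c. (r, c) \<in> R \<longleftrightarrow> l \<le> c \<and> c \<le> w \<and> c \<notin> set (s # S)"
    and sorted: "sorted_wrt (<) (s # S)"
    and S: "\<And>t. t \<in> set (s # S) \<Longrightarrow> l \<le> t \<and> t \<le> w + 1 \<and> odd (r + t)"
    and below: "\<And>t c. t \<in> set S \<Longrightarrow> s + 1 \<le> c \<Longrightarrow> c < t \<Longrightarrow> (r + 1, c) \<in> R"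
    and tail: "odd (r + w) \<or> w + 1 \<in> set (s # S)"
  shows "num_tilings R = (\<Sum>T\<in>listset (gaps r (s + 1) S). num_tilings (R - {r} \<times> UNIV - Pair (r + 1) ` set T))"
proof -
  let ?R = "R - {r} \<times> {l..<s}"
  have s: "l \<le> s" "s \<le> w + 1" "odd (r + s)" using S by auto
  have "even (s - l)" "0 \<le> s - l" using s l by presburger+
  then obtain n where n: "s - l = 2 * int n" by (rule even_nonneg_int)
  then have s_eq: "s = l + 2 * int n" by simp
  have s_less: "s < t" if "t \<in> set S" for t using sorted that by simp
  have "num_tilings R = num_tilings (R - {r} \<times> {l..<l + 2 * int n})"
    using fin above l row s(2) s_less unfolding s_eq by (intro num_tilings_forced_left) force+
  also have "\<dots> = num_tilings ?R" unfolding s_eq ..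
  also have "\<dots> = (\<Sum>T\<in>listset (gaps r (s + 1) S). num_tilings (?R - {r} \<times> UNIV - Pair (r + 1) ` set T))"
  proof (rule num_tilings_row_up)
    show "(r, c) \<in> ?R \<longleftrightarrow> s + 1 \<le> c \<and> c \<le> w \<and> c \<notin> set S" for c
    proof -
      have "(r, c) \<in> ?R \<longleftrightarrow> (r, c) \<in> R \<and> \<not> (l \<le> c \<and> c < s)" by simp
      then show ?thesis unfolding row using s(1) by auto
    qed
    show "s + 1 \<le> t \<and> t \<le> w + 1 \<and> odd (r + t)" if "t \<in> set S" for t
      using S[of t] s_less[OF that] that by auto
    show "even (r + (s + 1))" using s(3) by presburger
    show "odd (r + w) \<or> w + 1 \<in> set S \<or> w < s + 1" using tail by auto
    show "(r + 1, c) \<in> ?R" if "t \<in> set S" "s + 1 \<le> c" "c < t" for t c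
      using below that s(1) by auto
  qed (use fin above sorted in auto)
  also have "?R - {r} \<times> UNIV = R - {r} \<times> UNIV" by auto
  finally show ?thesis .
qed

section \<open>Sweeping the region from top to bottom\<close>

text \<open>The set \<open>Q\<close> will contain even rows, whose leftmost triangle points up.
  Without that triangle such a row begins with a down-pointing one, as the odd rows do, and so
  becomes an exit too.\<close>

definition row_start :: "nat set \<Rightarrow> nat \<Rightarrow> int" where
  "row_start Q r = (if r \<in> Q then 1 else 0)"

definition row_end :: "nat \<Rightarrow> nat \<Rightarrow> nat \<Rightarrow> int" where
  "row_end x m r = (if r < m then 2 * int x + 3 * int r else 2 * int x + 3 * int m - 3 - (int r - int m))"

text \<open>The rows from \<open>r\<close> on of the region whose tooth tips in the rows \<open>Q\<close> are removed,
  without the down-pointing triangles in row \<open>r\<close> at the positions \<open>S\<close>, which are covered from above.\<close>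

definition lower_part :: "nat \<Rightarrow> nat \<Rightarrow> nat \<Rightarrow> nat set \<Rightarrow> nat \<Rightarrow> int list \<Rightarrow> tri set" where
  "lower_part x m M Q r S =
     (\<Union>q\<in>{r..<M}. {int q} \<times> {row_start Q q..row_end x m q}) - Pair (int r) ` set S"

definition exits :: "nat \<Rightarrow> nat set \<Rightarrow> nat \<Rightarrow> nat list" where
  "exits M Q r = filter (\<lambda>e. odd e \<or> e \<in> Q) [r..<M]"

lemma mem_lower_part:
  "(int q, c) \<in> lower_part x m M Q r S \<longleftrightarrow> r \<le> q \<and> q < M \<and> row_start Q q \<le> c \<and> c \<le> row_end x m q
    \<and> (q = r \<longrightarrow> c \<notin> set S)"
  by (auto simp: lower_part_def)

lemma finite_lower_part: "finite (lower_part x m M Q r S)"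
  by (simp add: lower_part_def)

lemma lower_part_Suc:
  assumes "r < M"
  shows "lower_part x m M Q r S - {int r} \<times> UNIV - Pair (int r + 1) ` set T = lower_part x m M Q (Suc r) T"
proof -
  have "{r..<M} = insert r {Suc r..<M}" using assms by auto
  then show ?thesis by (auto simp: lower_part_def)
qed

text \<open>The rows of the determinant are the paths under way at the positions \<open>S\<close>,
  followed by those that still have to start, in the rows \<open>[r..<m]\<close>, just beyond the
  right end. In a row without exit all paths go on and only the functions change; in an exit row the
  first path ends and the column of that exit is split off.\<close>

lemma num_tilings_lower_part:
  assumes Q: "\<And>q. q \<in> Q \<Longrightarrow> even q" and m: "m \<le> M" "even M"
    and "r \<le> M" "sorted_wrt (<) S"
    and "\<And>s. s \<in> set S \<Longrightarrow> 0 \<le> s \<and> s \<le> row_end x m r \<and> odd (int r + s)"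
    and "length S + (m - r) = length (exits M Q r)"
  shows "real (num_tilings (lower_part x m M Q r S))
    = dt (map (paths r) S @ map (\<lambda>i. paths i (2 * int x + 3 * int i + 1)) [r..<m]) (exits M Q r)"
  using assms(4-)
proof (induction r arbitrary: S rule: inc_induct)
  case base
  then have "S = []" by (simp add: exits_def)
  then show ?case using m by (simp add: lower_part_def exits_def lozenge_tilings_empty)
next
  case (step r)
  let ?R = "lower_part x m M Q r S" and ?w = "row_end x m r" and ?l = "row_start Q r"
  let ?start = "\<lambda>i. paths i (2 * int x + 3 * int i + 1)"
  let ?post = "map ?start [Suc r..<m]"
  \<comment> \<open>A path starting in row \<open>r\<close> is treated as if the triangle just
    beyond the right end were covered from above.\<close>
  define S' where "S' = (if r < m then S @ [?w + 1] else S)"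
  have S: "0 \<le> s" "s \<le> ?w" "odd (int r + s)" if "s \<in> set S" for s using step.prems(2)[OF that] by auto
  have w: "?w = 2 * int x + 3 * int r" if "r < m" using that by (simp add: row_end_def)
  have w_nonneg: "?w \<ge> 0" if "r < m" using w[OF that] by simp
  have l: "?l = 0 \<or> ?l = 1 \<and> even r" using Q by (auto simp: row_start_def)
  have S'_mem: "?l \<le> s \<and> s \<le> ?w + 1 \<and> odd (int r + s) \<and> s \<ge> 0" if "s \<in> set S'" for s
  proof -
    have "s = ?w + 1 \<and> r < m \<or> s \<in> set S" using that by (auto simp: S'_def split: if_splits)
    then have s: "0 \<le> s" "s \<le> ?w + 1" "odd (int r + s)" using S[of s] w w_nonneg by auto
    moreover have "?l \<le> s" using l s by presburger
    ultimately show ?thesis by blast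
  qed
  have sorted: "sorted_wrt (<) S'"
    using step.prems(1) S by (force simp: S'_def sorted_wrt_append)
  have len: "length S' + (m - Suc r) = length (exits M Q r)"
  proof -
    have "length S' + (m - Suc r) = length S + (m - r)" unfolding S'_def by (cases "r < m") auto
    then show ?thesis using step.prems(3) by simp
  qed
  have rows: "map (paths r) S @ map ?start [r..<m] = map (paths r) S' @ ?post"
  proof (cases "r < m")
    case True
    then have "map ?start [r..<m] = paths r (?w + 1) # ?post" using w by (simp add: upt_conv_Cons)
    then show ?thesis using True by (simp add: S'_def)
  qed (simp add: S'_def)
  have row: "(int r, c) \<in> ?R \<longleftrightarrow> ?l \<le> c \<and> c \<le> ?w \<and> c \<notin> set S'" for c
    using \<open>r < M\<close> by (auto simp: mem_lower_part S'_def)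
  have above: "(int r - 1, c) \<notin> ?R" for c by (auto simp: lower_part_def)
  have tail: "odd (int r + ?w) \<or> ?w + 1 \<in> set S'"
    by (auto simp: S'_def row_end_def)
  have w_next: "c \<le> row_end x m (Suc r)" if "s \<in> set S'" "c < s" for s c
  proof (cases "r < m")
    case True
    then show ?thesis using S'_mem[OF that(1)] that(2) w by (auto simp: row_end_def)
  next
    case False
    then have "s \<le> ?w" using S that(1) by (simp add: S'_def)
    then show ?thesis using that(2) False by (simp add: row_end_def)
  qed
  have IH: "real (num_tilings (?R - {int r} \<times> UNIV - Pair (int r + 1) ` set T))
      = dt (map (paths (Suc r)) T @ ?post) (exits M Q (Suc r))"
    if T: "T \<in> listset (gaps (int r) c U)" "\<forall>s\<in>set U. c \<le> s" "sorted_wrt (<) U" "set U \<subseteq> set S'" "0 \<le> c"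
      and len_U: "length U + (m - Suc r) = length (exits M Q (Suc r))" for T c U
    unfolding lower_part_Suc[OF \<open>r < M\<close>]
  proof (rule step.IH)
    note T' = listset_gaps[OF T(1-3)]
    show "sorted_wrt (<) T" using T' by blast
    show "length T + (m - Suc r) = length (exits M Q (Suc r))" using T' len_U by simp
    show "0 \<le> t \<and> t \<le> row_end x m (Suc r) \<and> odd (int (Suc r) + t)" if "t \<in> set T" for t
    proof -
      have t: "c \<le> t" "even (int r + t)" "\<exists>s\<in>set U. t < s" using T' that by simp_all
      then obtain s where s: "s \<in> set U" "t < s" by (elim bexE)
      have "t \<le> row_end x m (Suc r)" using s T(4) by (intro w_next[of s]) (simp_all add: subsetD)
      moreover have "odd (int (Suc r) + t)" using t(2) by simp
      ultimately show ?thesis using t(1) T(5) by linarith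
    qed
  qed
  have next_row: "(int r + 1, c) \<in> ?R"
    if "s \<in> set U" "set U \<subseteq> set S'" "0 \<le> c" "even r \<or> 1 \<le> c" "c < s"
      and len_U: "length U + (m - Suc r) = length (exits M Q (Suc r))" for s c U
  proof -
    have "Suc r < M"
    proof (rule ccontr)
      assume "\<not> Suc r < M"
      then have "exits M Q (Suc r) = []" by (simp add: exits_def)
      then show False using that(1) len_U by simp
    qed
    moreover have "row_start Q (Suc r) \<le> c"
      using Q[of "Suc r"] that(3,4) by (auto simp: row_start_def)
    ultimately show ?thesis
      using mem_lower_part[of "Suc r" c x m M Q r S] w_next[of s c] that by (auto simp: add.commute)
  qed
  have exits_r: "exits M Q r = (if odd r \<or> r \<in> Q then [r] else []) @ exits M Q (Suc r)"
    using \<open>r < M\<close> by (simp add: exits_def upt_conv_Cons)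
  show ?case
  proof (cases "odd r \<or> r \<in> Q")
    case False
    then have l0: "?l = 0" "even r" by (auto simp: row_start_def)
    have exits: "exits M Q r = exits M Q (Suc r)" using False exits_r by simp
    \<comment> \<open>With the virtual position -1 in front, the first gap has the same form as the
      others. The row it subtracts is 0 at all later exits.\<close>
    have sorted': "sorted_wrt (<) ((-1) # S')" using sorted S'_mem by force
    have "num_tilings ?R = (\<Sum>T\<in>listset (gaps (int r) 0 S').
        num_tilings (?R - {int r} \<times> UNIV - Pair (int r + 1) ` set T))"
    proof (rule num_tilings_row_up[where w = ?w])
      show "(int r + 1, c) \<in> ?R" if "s \<in> set S'" "0 \<le> c" "c < s" for s c
        using next_row[of s S' c] that len exits l0 by simp
    qed (use finite_lower_part above row l0 sorted S'_mem tail in auto)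
    then have "real (num_tilings ?R) = (\<Sum>T\<in>listset (gaps (int r) 0 S').
        dt ([] @ map (paths (Suc r)) T @ ?post) (exits M Q (Suc r)))"
      using IH[of _ 0 S'] S'_mem sorted len exits by simp
    also have "\<dots> = dt ([] @ map (\<lambda>A e. \<Sum>t\<in>A. paths (Suc r) t e) (gaps (int r) (- 1 + 1) S') @ ?post)
        (exits M Q (Suc r))"
      using len exits gaps_finite by (subst sum_dt_listset) auto
    also have "\<dots> = dt (diffs (paths r (-1)) (map (paths r) S') @ ?post) (exits M Q (Suc r))"
      using sorted' S'_mem l0 by (subst map_sum_gaps) auto
    also have "\<dots> = dt (map (paths r) S' @ ?post) (exits M Q (Suc r))"
    proof (cases S')
      case (Cons s U)
      have "dt (diffs (paths r (-1)) (map (paths r) S') @ ?post) (exits M Q (Suc r))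
        = dt ([] @ paths r s # diffs (paths r s) (map (paths r) U) @ ?post) (exits M Q (Suc r))"
      proof (rule dt_cong)
        fix i e assume "e \<in> set (exits M Q (Suc r))"
        then have "paths r (-1) e = 0" using l0 by (intro paths_start) (auto simp: exits_def)
        then show "((diffs (paths r (-1)) (map (paths r) S') @ ?post) ! i) e
          = (([] @ paths r s # diffs (paths r s) (map (paths r) U) @ ?post) ! i) e"
          unfolding Cons by (cases i) auto
      qed (use Cons len exits in auto)
      also have "\<dots> = dt ([] @ paths r s # map (paths r) U @ ?post) (exits M Q (Suc r))"
        using Cons len exits by (intro dt_diffs) auto
      finally show ?thesis using Cons by simp
    qed simp
    finally show ?thesis by (simp only: rows exits)
  next
    case True
    have exits: "exits M Q r = r # exits M Q (Suc r)" using True exits_r by simp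
    have parity: "odd (int r + ?l)" using True Q by (auto simp: row_start_def)
    have "S' \<noteq> []" using len exits by (auto simp: S'_def split: if_splits)
    then obtain s U where Cons: "S' = s # U" by (cases S') auto
    have s: "0 \<le> s" using S'_mem[of s] Cons by simp
    have U: "sorted_wrt (<) U" "\<forall>t\<in>set U. s + 1 \<le> t" "set U \<subseteq> set S'" "- 1 \<le> s"
      using sorted Cons s by auto
    have len_U: "length U + (m - Suc r) = length (exits M Q (Suc r))" using len exits Cons by simp
    have "num_tilings ?R = (\<Sum>T\<in>listset (gaps (int r) (s + 1) U).
        num_tilings (?R - {int r} \<times> UNIV - Pair (int r + 1) ` set T))"
    proof (rule num_tilings_row_down[where w = ?w])
      show "(int r + 1, c) \<in> ?R" if "t \<in> set U" "s + 1 \<le> c" "c < t" for t c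
        using next_row[of t U c] that len_U Cons s by auto
    qed (use finite_lower_part above row parity sorted S'_mem tail Cons in auto)
    then have "real (num_tilings ?R) = (\<Sum>T\<in>listset (gaps (int r) (s + 1) U).
        dt ([] @ map (paths (Suc r)) T @ ?post) (exits M Q (Suc r)))"
      using IH[of _ "s + 1" U] U len_U s by simp
    also have "\<dots> = dt ([] @ map (\<lambda>A e. \<Sum>t\<in>A. paths (Suc r) t e) (gaps (int r) (s + 1) U) @ ?post)
        (exits M Q (Suc r))"
      using len_U gaps_finite by (subst sum_dt_listset) auto
    also have "\<dots> = dt (diffs (paths r s) (map (paths r) U) @ ?post) (exits M Q (Suc r))"
      using sorted S'_mem U(4) Cons by (subst map_sum_gaps) auto
    \<comment> \<open>In column \<open>r\<close> the differences and all paths that start later are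
      0, while the path at \<open>s\<close> has the value 1. So this row and this column can be
      added without changing the determinant.\<close>
    also have "\<dots> = dt (paths r s # diffs (paths r s) (map (paths r) U) @ ?post) (exits M Q r)"
    proof -
      have "v r = 0" if "v \<in> set (diffs (paths r s') (map (paths r) U'))" for v s' U'
        using that by (induction U' arbitrary: s') auto
      then show ?thesis unfolding exits using len_U by (subst dt_Cons_block) auto
    qed
    also have "\<dots> = dt (map (paths r) S' @ ?post) (exits M Q r)"
      using dt_diffs[of "exits M Q r" "[]" "map (paths r) U" ?post "paths r s"] len_U
      by (simp add: exits Cons)
    finally show ?thesis by (simp only: rows)
  qed
qed

section \<open>The determinant of path counts\<close>

declare upt_Suc [simp del]

text \<open>This is \<open>paths\<close> with the starting position of row \<open>i\<close>
  inserted.\<close>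

definition entry :: "nat \<Rightarrow> nat \<Rightarrow> nat \<Rightarrow> real" where
  "entry x i e = (if i \<le> e then of_nat ((x + i + (e + 1) div 2) choose (e - i)) else 0)"

abbreviation odds :: "nat \<Rightarrow> nat list" where
  "odds N \<equiv> map (\<lambda>j. 2 * j + 1) [0..<N]"

abbreviation evens :: "nat list \<Rightarrow> nat list" where
  "evens E \<equiv> map (\<lambda>j. 2 * j) E"

text \<open>The odd columns come first, so that a row vanishing in all of them splits off a block.
  \<open>E\<close> lists half the row numbers of the even exits.\<close>

definition path_det :: "nat \<Rightarrow> nat \<Rightarrow> nat list \<Rightarrow> real" where
  "path_det x N E = dt (map (entry x) [0..<N + length E]) (odds N @ evens E)"

lemma paths_eq_entry: "paths i (2 * int x + 3 * int i + 1) = entry x i"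
proof
  fix e
  show "paths i (2 * int x + 3 * int i + 1) e = entry x i e"
  proof (cases "i \<le> e")
    case True
    have "2 * int x + 3 * int i + 1 - 1 + int (e mod 2) + int e - int i = 2 * int (x + i + (e + 1) div 2)"
      by (cases "even e") (auto elim!: evenE oddE)
    then have "nat ((2 * int x + 3 * int i + 1 - 1 + int (e mod 2) + int e - int i) div 2) = x + i + (e + 1) div 2"
      by (simp only:) simp
    then show ?thesis using True unfolding paths_def entry_def by (simp only: if_True)
  qed (simp add: paths_def entry_def)
qed

section \<open>The region and its determinant\<close>

text \<open>The tooth tip number \<open>i\<close> lies in row \<open>2 * (i - 1)\<close>, hence the
  passage from \<open>{y + 1..y + a}\<close> to \<open>{y..<y + a}\<close>.\<close>

lemma region_R_eq_lower_part:
  "region_R x y z a = lower_part x (y + z + 2 * a) (2 * (y + z + a)) ((\<lambda>j. 2 * j) ` {y..<y + a}) 0 []"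
proof (rule Set.set_eqI)
  fix u :: tri
  obtain r c where u: "u = (r, c)" by force
  let ?Q = "(\<lambda>j. 2 * j) ` {y..<y + a}"
  let ?m = "y + z + 2 * a" and ?M = "2 * (y + z + a)"
  show "u \<in> region_R x y z a \<longleftrightarrow> u \<in> lower_part x ?m ?M ?Q 0 []"
  proof (cases "r \<ge> 0")
    case False
    then show ?thesis by (auto simp: u region_R_def pentagon_def lower_part_def)
  next
    case True
    then obtain q where q: "r = int q" by (metis nonneg_int_cases)
    have west: "u \<in> west_up ` {y + 1..y + a} \<longleftrightarrow> c = 0 \<and> q \<in> ?Q"
    proof
      assume "u \<in> west_up ` {y + 1..y + a}"
      then obtain i where i: "y + 1 \<le> i" "i \<le> y + a" "u = west_up i" by auto
      then have "c = 0" "q = 2 * (i - 1)" using u q by (auto simp: west_up_def)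
      moreover have "i - 1 \<in> {y..<y + a}" using i(1,2) by auto
      ultimately show "c = 0 \<and> q \<in> ?Q" by blast
    next
      assume "c = 0 \<and> q \<in> ?Q"
      then obtain j where "c = 0" "q = 2 * j" "y \<le> j" "j < y + a" by auto
      then have "u = west_up (j + 1)" "j + 1 \<in> {y + 1..y + a}" using u q by (auto simp: west_up_def)
      then show "u \<in> west_up ` {y + 1..y + a}" by blast
    qed
    have "u \<in> pentagon x ?m (y + z) \<longleftrightarrow> q < ?M \<and> 0 \<le> c \<and> c \<le> row_end x ?m q"
      by (auto simp: u q pentagon_def row_end_def)
    moreover have "row_start ?Q q \<le> c \<longleftrightarrow> 0 \<le> c \<and> \<not> (c = 0 \<and> q \<in> ?Q)"
      by (auto simp: row_start_def)
    ultimately show ?thesis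
      using west unfolding region_R_def u q mem_lower_part by auto
  qed
qed

lemma mset_exits:
  "mset (exits (2 * (y + z + a)) ((\<lambda>j. 2 * j) ` {y..<y + a}) 0) = mset (odds (y + z + a) @ evens [y..<y + a])"
proof -
  have "distinct (odds (y + z + a) @ evens [y..<y + a])"
    by (auto simp: distinct_map inj_on_def) presburger
  moreover have "distinct (exits (2 * (y + z + a)) ((\<lambda>j. 2 * j) ` {y..<y + a}) 0)"
    by (simp add: exits_def)
  moreover have "set (exits (2 * (y + z + a)) ((\<lambda>j. 2 * j) ` {y..<y + a}) 0)
    = set (odds (y + z + a) @ evens [y..<y + a])"
    by (auto simp: exits_def elim!: oddE)
  ultimately show ?thesis by (simp only: set_eq_iff_mset_eq_distinct)
qed

text \<open>Moving the even exits behind the odd ones may change the sign of the determinant. The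
  absolute value absorbs this, since the count is nonnegative.\<close>

lemma num_tilings_region_R:
  "real (num_tilings (region_R x y z a)) = \<bar>path_det x (y + z + a) [y..<y + a]\<bar>"
proof -
  let ?Q = "(\<lambda>j. 2 * j) ` {y..<y + a}"
  let ?m = "y + z + 2 * a" and ?M = "2 * (y + z + a)"
  have len: "length (exits ?M ?Q 0) = ?m"
    using arg_cong[OF mset_exits[of y z a], of size] by simp
  have "real (num_tilings (region_R x y z a))
    = dt (map (paths 0) [] @ map (\<lambda>i. paths i (2 * int x + 3 * int i + 1)) [0..<?m]) (exits ?M ?Q 0)"
    unfolding region_R_eq_lower_part using len by (intro num_tilings_lower_part) auto
  also have "\<dots> = dt (map (entry x) [0..<?m]) (exits ?M ?Q 0)"
    by (simp add: paths_eq_entry)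
  finally have "real (num_tilings (region_R x y z a)) = \<bar>dt (map (entry x) [0..<?m]) (exits ?M ?Q 0)\<bar>"
    by (metis abs_of_nat)
  also have "\<dots> = \<bar>dt (map (entry x) [0..<?m]) (odds (y + z + a) @ evens [y..<y + a])\<bar>"
    using len by (intro dt_permute_columns mset_exits) simp
  also have "?m = y + z + a + length [y..<y + a]" by simp
  finally show ?thesis unfolding path_det_def .
qed

text \<open>Without a hole the exits are in natural order already, so the determinant itself is a
  number of tilings. This fixes the sign in \<open>path_det_Nil\<close>.\<close>

lemma path_det_nonneg: "path_det x N [] \<ge> 0"
proof -
  have "exits (2 * N) {} 0 = odds N"
    by (induction N) (simp_all add: exits_def upt_Suc)
  moreover have "real (num_tilings (lower_part x N (2 * N) {} 0 []))
    = dt (map (paths 0) [] @ map (\<lambda>i. paths i (2 * int x + 3 * int i + 1)) [0..<N]) (exits (2 * N) {} 0)"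
    by (rule num_tilings_lower_part) (simp_all add: \<open>exits (2 * N) {} 0 = odds N\<close>)
  ultimately have "path_det x N [] = real (num_tilings (lower_part x N (2 * N) {} 0 []))"
    by (simp add: path_det_def paths_eq_entry)
  then show ?thesis by simp
qed

section \<open>Deleting the first row, and condensation of path determinants\<close>

text \<open>Expand the vanishing determinant that has the sum of \<open>u\<close> and
  \<open>v\<close> in both places.\<close>

lemma dt_swap_rows:
  assumes "length cs = length pre + length post + 2"
  shows "dt (pre @ u # v # post) cs = - dt (pre @ v # u # post) cs"
proof -
  let ?w = "\<lambda>c. 1 * u c + 1 * v c"
  have eq0: "dt (pre @ w # w # post) cs = 0" for w
    by (rule dt_identical_rows[of _ _ "length pre" "Suc (length pre)"])
      (use assms in \<open>auto simp: nth_append\<close>)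
  have "0 = dt (pre @ ?w # ?w # post) cs" by (rule eq0[symmetric])
  also have "\<dots> = dt (pre @ u # ?w # post) cs + dt (pre @ v # ?w # post) cs"
    using assms by (subst dt_row_linear) auto
  also have "dt (pre @ u # ?w # post) cs = dt (pre @ u # v # post) cs"
    using dt_row_linear[of cs "pre @ [u]" post 1 u 1 v] assms eq0 by simp
  also have "dt (pre @ v # ?w # post) cs = dt (pre @ v # u # post) cs"
    using dt_row_linear[of cs "pre @ [v]" post 1 u 1 v] assms eq0 by simp
  finally show ?thesis by simp
qed

lemma dt_move_row:
  assumes "length cs = length pre + length vs + length post + 1"
  shows "dt (pre @ vs @ u # post) cs = (-1) ^ length vs * dt (pre @ u # vs @ post) cs"
  using assms
proof (induction vs arbitrary: pre)
  case (Cons v vs)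
  have "dt (pre @ (v # vs) @ u # post) cs = (-1) ^ length vs * dt (pre @ v # u # vs @ post) cs"
    using Cons.IH[of "pre @ [v]"] Cons.prems by simp
  then show ?case
    using dt_swap_rows[of cs pre "vs @ post" v u] Cons.prems by simp
qed simp

lemma dt_move_column:
  assumes "length vs = length pre + length cs + length post + 1"
  shows "dt vs (pre @ cs @ c # post) = (-1) ^ length cs * dt vs (pre @ c # cs @ post)"
  using dt_move_row[of vs "map (\<lambda>c v. v c) pre" "map (\<lambda>c v. v c) cs" "map (\<lambda>c v. v c) post" "\<lambda>v. v c"] assms
    dt_transpose[of vs "pre @ cs @ c # post"] dt_transpose[of vs "pre @ c # cs @ post"]
  by simp

text \<open>\<open>path_det\<close> with its window of rows moved down by one. Such minors appear
  when condensation removes row 0.\<close>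

definition shifted_det :: "nat \<Rightarrow> nat \<Rightarrow> nat list \<Rightarrow> real" where
  "shifted_det x N E = dt (map (entry x) [1..<Suc (N + length E)]) (odds N @ evens E)"

text \<open>Without row 0, the only nonzero entry of column 1 is a 1 in row 1. Once these are struck
  out, rows and columns are lowered by 2. In the upper index of the binomial coefficient this costs
  2 through \<open>i\<close> and 1 through \<open>(e + 1) div 2\<close>, so \<open>x\<close> becomes
  \<open>x + 3\<close>.\<close>

lemma shifted_det_Suc:
  "shifted_det x (Suc N) (map Suc E) = path_det (x + 3) N E"
proof -
  let ?n = "N + length E"
  have rows: "map (entry x) [1..<Suc (Suc ?n)] = entry x 1 # map (\<lambda>i. entry x (i + 2)) [0..<?n]"
  proof -
    have "[1..<Suc (Suc ?n)] = 1 # map (\<lambda>i. i + 2) [0..<?n]"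
      using map_add_upt[of 2 ?n] by (simp add: upt_conv_Cons numeral_2_eq_2)
    then show ?thesis by (simp only: list.map map_map comp_def)
  qed
  have columns: "odds (Suc N) @ evens (map Suc E) = 1 # map (\<lambda>e. e + 2) (odds N @ evens E)"
    by (simp add: upt_conv_Cons map_Suc_upt[symmetric] comp_def)
  have "shifted_det x (Suc N) (map Suc E)
    = dt (entry x 1 # map (\<lambda>i. entry x (i + 2)) [0..<?n]) (1 # map (\<lambda>e. e + 2) (odds N @ evens E))"
    by (simp only: shifted_det_def columns rows length_map add_Suc)
  also have "\<dots> = dt (map (\<lambda>i. entry x (i + 2)) [0..<?n]) (map (\<lambda>e. e + 2) (odds N @ evens E))"
    by (subst dt_Cons_block) (auto simp: entry_def)
  also have "\<dots> = dt (map (\<lambda>v c. v (c + 2)) (map (\<lambda>i. entry x (i + 2)) [0..<?n])) (odds N @ evens E)"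
    by (rule dt_map_columns) simp
  also have "map (\<lambda>v c. v (c + 2)) (map (\<lambda>i. entry x (i + 2)) [0..<?n]) = map (entry (x + 3)) [0..<?n]"
  proof -
    have "entry x (i + 2) (e + 2) = entry (x + 3) i e" for i e
    proof -
      have "x + (i + 2) + (e + 2 + 1) div 2 = x + 3 + i + (e + 1) div 2" by simp
      then show ?thesis by (simp only: entry_def diff_cancel2 add_le_cancel_right)
    qed
    then show ?thesis by simp
  qed
  finally show ?thesis by (simp add: path_det_def)
qed

lemma shifted_det_0: "shifted_det x N (0 # E) = 0"
proof -
  have "shifted_det x N (0 # E)
    = (-1) ^ N * dt (map (entry x) [1..<Suc (N + length (0 # E))]) (0 # odds N @ evens E)"
    using dt_move_column[of "map (entry x) [1..<Suc (N + length (0 # E))]" "[]" "odds N" "evens E" 0]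
    by (simp add: shifted_det_def)
  also have "dt (map (entry x) [1..<Suc (N + length (0 # E))]) (0 # odds N @ evens E) = 0"
    by (simp add: upt_conv_Cons) (subst dt_Cons_block; auto simp: entry_def)
  finally show ?thesis by simp
qed

text \<open>Column 0 has its only nonzero entry in row 0. Splitting off both leaves a determinant
  without row 0, up to the sign of moving column 0 to the front.\<close>

lemma path_det_0_Cons: "\<bar>path_det x (Suc N) (0 # map Suc E)\<bar> = \<bar>path_det (x + 3) N E\<bar>"
proof -
  let ?n = "Suc N + length E"
  have "path_det x (Suc N) (0 # map Suc E)
    = (-1) ^ Suc N * dt (map (entry x) [0..<Suc ?n]) (0 # odds (Suc N) @ evens (map Suc E))"
    using dt_move_column[of "map (entry x) [0..<Suc ?n]" "[]" "odds (Suc N)" "evens (map Suc E)" 0]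
    by (simp add: path_det_def)
  also have "dt (map (entry x) [0..<Suc ?n]) (0 # odds (Suc N) @ evens (map Suc E))
    = shifted_det x (Suc N) (map Suc E)"
  proof -
    have "map (entry x) [0..<Suc ?n] = entry x 0 # map (entry x) [1..<Suc ?n]"
      by (simp add: upt_conv_Cons)
    then show ?thesis
      unfolding shifted_det_def by (simp only: length_map) (subst dt_Cons_block; auto simp: entry_def)
  qed
  finally show ?thesis by (simp add: shifted_det_Suc abs_mult)
qed

text \<open>Distinguished are the first and the last row and the outermost even columns
  \<open>2 * y\<close> and \<open>2 * (y + a + 1)\<close>. All odd columns and the inner even ones
  belong to the common minor.\<close>

lemma path_det_condensation:
  assumes nz: "shifted_det x N [Suc y..<Suc (y + a)] \<noteq> 0"
  shows "path_det x N [y..<y + a + 2] * shifted_det x N [Suc y..<Suc (y + a)]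
    = path_det x N [y..<y + a + 1] * shifted_det x N [Suc y..<y + a + 2]
      - path_det x N [Suc y..<y + a + 2] * shifted_det x N [y..<y + a + 1]"
proof -
  define k where "k = N + a"
  define vs where "vs = map (entry x) [1..<Suc k]"
  define inner where "inner = evens [Suc y..<Suc (y + a)]"
  define u v where "u = entry x 0" and "v = entry x (Suc k)"
  define c d where "c = 2 * y" and "d = 2 * (y + a + 1)"
  let ?cs = "odds N @ inner"
  have len: "length vs = k" "length inner = a" by (simp_all add: vs_def inner_def)
  have upt: "[y..<y + a + 2] = y # [Suc y..<Suc (y + a)] @ [Suc (y + a)]"
    "[y..<y + a + 1] = y # [Suc y..<Suc (y + a)]"
    "[Suc y..<y + a + 2] = [Suc y..<Suc (y + a)] @ [Suc (y + a)]"
    using upt_Suc_append[of y "Suc (y + a)"] upt_Suc_append[of "Suc y" "Suc (y + a)"]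
    by (simp_all add: upt_conv_Cons[of y])
  have E: "evens [y..<y + a + 2] = c # inner @ [d]" "evens [y..<y + a + 1] = c # inner"
    "evens [Suc y..<y + a + 2] = inner @ [d]" "evens [Suc y..<Suc (y + a)] = inner"
    unfolding upt by (simp_all add: inner_def c_def d_def)
  have "[0..<Suc k] = 0 # [1..<Suc k]" "[0..<Suc (Suc k)] = 0 # [1..<Suc k] @ [Suc k]"
    "[1..<Suc (Suc k)] = [1..<Suc k] @ [Suc k]"
    using upt_Suc_append[of 1 "Suc k"] by (simp_all add: upt_conv_Cons[of 0])
  then have rows: "map (entry x) [0..<Suc k] = u # vs" "map (entry x) [0..<Suc (Suc k)] = u # vs @ [v]"
    "map (entry x) [1..<Suc (Suc k)] = vs @ [v]"
    by (simp_all only: vs_def u_def v_def list.map map_append)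
  have lens: "N + length [y..<y + a + 2] = Suc (Suc k)" "N + length [y..<y + a + 1] = Suc k"
    "N + length [Suc y..<y + a + 2] = Suc k" "N + length [Suc y..<Suc (y + a)] = k"
    by (simp_all add: k_def)
  \<comment> \<open>\<open>s\<close> is the sign of moving row 0 past the \<open>k\<close> inner
    rows, \<open>t\<close> that of moving column \<open>c\<close> past the \<open>a\<close> inner
    even columns. Each of the three products acquires the factor \<open>s * t\<close>.\<close>
  define s t :: real where "s = (-1) ^ k" and "t = (-1) ^ a"
  have D: "path_det x N [y..<y + a + 2] = dt (u # vs @ [v]) (odds N @ c # inner @ [d])"
    "path_det x N [y..<y + a + 1] = dt (u # vs) (odds N @ c # inner)"
    "path_det x N [Suc y..<y + a + 2] = dt (u # vs) (odds N @ inner @ [d])"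
    "shifted_det x N [Suc y..<Suc (y + a)] = dt vs ?cs"
    "shifted_det x N [Suc y..<y + a + 2] = dt (vs @ [v]) (odds N @ inner @ [d])"
    "shifted_det x N [y..<y + a + 1] = dt (vs @ [v]) (odds N @ c # inner)"
    unfolding path_det_def shifted_det_def E lens rows vs_def by (rule refl)+
  have "dt (vs @ [u, v]) (?cs @ [c, d]) = s * dt (u # vs @ [v]) (?cs @ [c, d])"
    using dt_move_row[of "?cs @ [c, d]" "[]" vs "[v]" u] len by (simp add: s_def k_def)
  also have "dt (u # vs @ [v]) (?cs @ [c, d]) = t * dt (u # vs @ [v]) (odds N @ c # inner @ [d])"
    using dt_move_column[of "u # vs @ [v]" "odds N" inner "[d]" c] len by (simp add: t_def k_def)
  finally have 1: "dt (vs @ [u, v]) (?cs @ [c, d]) = s * t * path_det x N [y..<y + a + 2]"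
    by (simp only: D mult.assoc)
  have "dt (vs @ [u]) (?cs @ [c]) = s * dt (u # vs) (?cs @ [c])"
    using dt_move_row[of "?cs @ [c]" "[]" vs "[]" u] len by (simp add: s_def k_def)
  also have "dt (u # vs) (?cs @ [c]) = t * dt (u # vs) (odds N @ c # inner)"
    using dt_move_column[of "u # vs" "odds N" inner "[]" c] len by (simp add: t_def k_def)
  finally have 2: "dt (vs @ [u]) (?cs @ [c]) = s * t * path_det x N [y..<y + a + 1]"
    by (simp only: D mult.assoc)
  have 3: "dt (vs @ [u]) (?cs @ [d]) = s * path_det x N [Suc y..<y + a + 2]"
    unfolding D using dt_move_row[of "?cs @ [d]" "[]" vs "[]" u] len by (simp add: s_def k_def)
  have 4: "dt (vs @ [v]) (?cs @ [c]) = t * shifted_det x N [y..<y + a + 1]"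
    unfolding D using dt_move_column[of "vs @ [v]" "odds N" inner "[]" c] len by (simp add: t_def k_def)
  have 5: "dt (vs @ [v]) (?cs @ [d]) = shifted_det x N [Suc y..<y + a + 2]"
    unfolding D by simp
  have "dt (vs @ [u, v]) (?cs @ [c, d]) * dt vs ?cs
    = dt (vs @ [u]) (?cs @ [c]) * dt (vs @ [v]) (?cs @ [d])
      - dt (vs @ [u]) (?cs @ [d]) * dt (vs @ [v]) (?cs @ [c])"
    by (rule dt_condensation) (use len nz D(4) in \<open>simp_all add: k_def\<close>)
  then have "s * t * (path_det x N [y..<y + a + 2] * dt vs ?cs)
    = s * t * (path_det x N [y..<y + a + 1] * shifted_det x N [Suc y..<y + a + 2]
      - path_det x N [Suc y..<y + a + 2] * shifted_det x N [y..<y + a + 1])"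
    unfolding 1 2 3 4 5 by (simp add: algebra_simps)
  moreover have "s * t \<noteq> 0" by (simp add: s_def t_def)
  ultimately show ?thesis unfolding D(4) using mult_left_cancel by blast
qed

text \<open>Putting the combination in the place of the last row multiplies the determinant by
  \<open>c N\<close>, and leaves in that row only the entry of the even column.\<close>

lemma path_det_replace_row:
  assumes "\<And>j. j < N \<Longrightarrow> (\<Sum>i\<le>N. c i * entry x i (2 * j + 1)) = 0"
  shows "c N * path_det x N [k] = path_det x N [] * (\<Sum>i\<le>N. c i * entry x i (2 * k))"
proof -
  let ?vs = "map (entry x) [0..<N]"
  let ?w = "\<lambda>e. c N * entry x N e + (\<Sum>i<length ?vs. c i * (?vs ! i) e)"
  have w: "?w e = (\<Sum>i\<le>N. c i * entry x i e)" for e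
    by (simp add: lessThan_Suc_atMost[symmetric])
  have "c N * path_det x N [k] = dt (?vs @ ?w # []) (odds N @ [2 * k])"
    by (subst dt_add_rows) (simp_all add: path_det_def upt_Suc)
  also have "\<dots> = dt ?vs (odds N) * dt [?w] [2 * k]"
    using assms unfolding w by (intro dt_block) auto
  finally show ?thesis by (simp add: dt_single w path_det_def del: length_map)
qed

section \<open>A row combination that vanishes in the odd columns\<close>

text \<open>A hypergeometric sequence given by its term ratio. The factor \<open>N - i\<close> in
  the numerator makes it end after index \<open>N\<close>.\<close>

fun kcoeff :: "nat \<Rightarrow> nat \<Rightarrow> nat \<Rightarrow> real" where
  "kcoeff x N 0 = 1"
| "kcoeff x N (Suc i) = kcoeff x N i * (- 2 * (real N - real i) * (2 * real i + 2 * real N + 2 * real x + 3) * (real x + 1 + real i))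
    / ((real i + 1) * (2 * real N - real i) * (real i + 2 * real N + 2 * real x + 3))"

text \<open>The only denominator that can vanish is \<open>2 * N - i\<close>, for
  \<open>N = 0\<close>; then both sides are 0.\<close>

lemma kcoeff_rec:
  assumes "i \<le> N"
  shows "kcoeff x N (Suc i) * (real i + 1) * (2 * real N - real i) * (real i + 2 * real N + 2 * real x + 3)
    = - 2 * (real N - real i) * (2 * real i + 2 * real N + 2 * real x + 3) * (real x + 1 + real i) * kcoeff x N i"
proof (cases "N = 0")
  case False
  then have "2 * real N - real i \<noteq> 0" "real i + 1 \<noteq> 0" "real i + 2 * real N + 2 * real x + 3 \<noteq> 0"
    using assms by simp_all
  then show ?thesis by simp
qed (use assms in simp)

section \<open>The values of the combination in the odd and even columns\<close>

text \<open>The function 1 / Gamma(k + 1) at integers. With the value 0 at negative arguments,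
  \<open>ifact_rec\<close> holds without exception, so the boundaries of the sums need no case
  distinction.\<close>

definition ifact :: "int \<Rightarrow> real" where
  "ifact k = (if k < 0 then 0 else 1 / fact (nat k))"

lemma ifact_rec: "of_int k * ifact k = ifact (k - 1)"
proof (cases "k > 0")
  case True
  then obtain n where "k = int (Suc n)" by (metis gr0_implies_Suc zero_less_imp_eq_int)
  then show ?thesis by (simp add: ifact_def nat_add_distrib)
qed (auto simp: ifact_def)

lemma ifact_step: "l = k + 1 \<Longrightarrow> r = real_of_int l \<Longrightarrow> ifact k = r * ifact l"
  using ifact_rec[of l] by simp

lemma binomial_ifact:
  "(if k \<le> m then of_nat (n choose (m - k)) else 0) = fact n * ifact (int m - int k) * ifact (int n - (int m - int k))"
proof (cases "k \<le> m \<and> m - k \<le> n")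
  case True
  then have "nat (int m - int k) = m - k" "nat (int n - (int m - int k)) = n - (m - k)"
    "\<not> int m - int k < 0" "\<not> int n - (int m - int k) < 0" by linarith+
  then show ?thesis using True by (simp only: ifact_def if_False) (simp add: binomial_fact)
qed (auto simp: ifact_def binomial_eq_0)

text \<open>The value in column \<open>2 * j - 1\<close>. This indexing lets the induction start at
  \<open>j = 0\<close>, a fictitious column -1 in which the sum is 0.\<close>

definition odd_sum :: "nat \<Rightarrow> nat \<Rightarrow> nat \<Rightarrow> real" where
  "odd_sum x N j = (\<Sum>i\<le>N. kcoeff x N i * (fact (x + i + j)
    * ifact (2 * int j - 1 - int i) * ifact (int x - int j + 1 + 2 * int i)))"

definition even_sum :: "nat \<Rightarrow> nat \<Rightarrow> nat \<Rightarrow> real" where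
  "even_sum x N j = (\<Sum>i\<le>N. kcoeff x N i * (fact (x + i + j)
    * ifact (2 * int j - int i) * ifact (int x - int j + 2 * int i)))"

lemma odd_sum_entry: "(\<Sum>i\<le>N. kcoeff x N i * entry x i (2 * j + 1)) = odd_sum x N (Suc j)"
proof -
  have "entry x i (2 * j + 1) = fact (x + i + Suc j) * ifact (2 * int (Suc j) - 1 - int i)
      * ifact (int x - int (Suc j) + 1 + 2 * int i)" for i
  proof -
    have "x + i + (2 * j + 1 + 1) div 2 = x + i + Suc j" "2 * int (Suc j) - 1 - int i = int (2 * j + 1) - int i"
      "int x - int (Suc j) + 1 + 2 * int i = int (x + i + Suc j) - (int (2 * j + 1) - int i)"
      by simp_all
    then show ?thesis unfolding entry_def by (simp only: binomial_ifact)
  qed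
  then show ?thesis unfolding odd_sum_def by simp
qed

lemma even_sum_entry: "(\<Sum>i\<le>N. kcoeff x N i * entry x i (2 * j)) = even_sum x N j"
proof -
  have "entry x i (2 * j) = fact (x + i + j) * ifact (2 * int j - int i) * ifact (int x - int j + 2 * int i)" for i
  proof -
    have "x + i + (2 * j + 1) div 2 = x + i + j" "2 * int j - int i = int (2 * j) - int i"
      "int x - int j + 2 * int i = int (x + i + j) - (int (2 * j) - int i)"
      by simp_all
    then show ?thesis unfolding entry_def by (simp only: binomial_ifact)
  qed
  then show ?thesis unfolding even_sum_def by simp
qed

lemma odd_sum_0: "odd_sum x N 0 = 0"
  by (simp add: odd_sum_def ifact_def)

lemma even_sum_0: "even_sum x N 0 = 1"
proof -
  have "even_sum x N 0 = (\<Sum>i\<in>{0}. kcoeff x N i * entry x i (2 * 0))"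
    unfolding even_sum_entry[symmetric] by (rule sum.mono_neutral_right) (auto simp: entry_def)
  then show ?thesis by (simp add: entry_def)
qed

lemma odd_sum_1:
  assumes "N > 0"
  shows "odd_sum x N 1 = 0"
proof -
  have "odd_sum x N 1 = (\<Sum>i\<in>{0, 1}. kcoeff x N i * entry x i (2 * 0 + 1))"
    unfolding One_nat_def odd_sum_entry[symmetric]
    by (rule sum.mono_neutral_right) (use assms in \<open>auto simp: entry_def\<close>)
  also have "\<dots> = real x + 1 + kcoeff x N 1"
    by (simp add: entry_def)
  also have "kcoeff x N 1 = - (real x + 1)"
  proof -
    have "2 * real N + 2 * real x + 3 \<noteq> 0" by simp
    then show ?thesis using assms by (simp add: divide_simps)
  qed
  finally show ?thesis by simp
qed

text \<open>With \<open>E\<close> the summand and \<open>Q\<close>, \<open>P\<close> the two polynomials below, \<open>P i * E i = Q (i + 1) * E (i + 1)\<close>,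
  so that the sum telescopes; this is the certificate for the two recurrences that follow.\<close>

lemma telescoping_sum:
  fixes x N j :: nat and K v :: int
  defines "E \<equiv> \<lambda>i. kcoeff x N i * (fact (x + i + j) * ifact (K - int i) * ifact (v + 2 * int i))"
    and "Q \<equiv> \<lambda>i. real i * (2 * real N + 1 - real i) * (real i + 2 * real N + 2 * real x + 2)
      * (of_int v + 2 * real i) * (of_int v + 2 * real i - 1)"
    and "P \<equiv> \<lambda>i. - 2 * (real N - real i) * (2 * real i + 2 * real N + 2 * real x + 3) * (real x + 1 + real i)
      * (real x + real i + real j + 1) * (of_int K - real i)"
  shows "(\<Sum>i\<le>N. (P i - Q i) * E i) = 0"
proof -
  define u where "u i = of_int v + 2 * real i" for i
  have f: "fact (x + Suc i + j) = (real x + real i + real j + 1) * (fact (x + i + j) :: real)" for i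
    by (simp add: algebra_simps)
  have k: "ifact (K - int (Suc i)) = (of_int K - real i) * ifact (K - int i)" for i
    by (rule ifact_step) simp_all
  have shift: "ifact (v + 2 * int i) = (u i + 1) * ((u i + 2) * ifact (v + 2 * int (Suc i)))" for i
  proof -
    have "ifact (v + 2 * int i) = (u i + 1) * ifact (v + 1 + 2 * int i)"
      "ifact (v + 1 + 2 * int i) = (u i + 2) * ifact (v + 2 * int (Suc i))"
      by (rule ifact_step; simp add: u_def)+
    then show ?thesis by simp
  qed
  have QE: "Q (Suc i) * E (Suc i) = P i * E i" if "i \<le> N" for i
  proof -
    let ?I = "ifact (v + 2 * int (Suc i))"
    have Q_Suc: "Q (Suc i) = (real i + 1) * (2 * real N - real i) * (real i + 2 * real N + 2 * real x + 3)
      * (u i + 2) * (u i + 1)"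
      unfolding Q_def u_def of_nat_Suc by Groebner_Basis.algebra
    have "Q (Suc i) * E (Suc i) = (kcoeff x N (Suc i) * (real i + 1) * (2 * real N - real i)
        * (real i + 2 * real N + 2 * real x + 3)) * ((u i + 1) * ((u i + 2) * ?I))
        * fact (x + Suc i + j) * ifact (K - int (Suc i))"
      unfolding Q_Suc E_def by (simp only: mult_ac)
    also have "\<dots> = P i * E i"
      unfolding shift[symmetric] kcoeff_rec[OF that] k f P_def E_def by (simp only: mult_ac)
    finally show ?thesis .
  qed
  have "(\<Sum>i\<le>N. (P i - Q i) * E i) = (\<Sum>i\<le>N. Q (Suc i) * E (Suc i) - Q i * E i)"
    by (rule sum.cong) (simp_all only: QE atMost_iff left_diff_distrib)
  also have "\<dots> = Q (Suc N) * E (Suc N) - Q 0 * E 0"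
    using sum_lessThan_telescope[of "\<lambda>i. Q i * E i" "Suc N"] by (simp add: lessThan_Suc_atMost)
  \<comment> \<open>\<open>Q 0\<close> contains the factor 0, and \<open>kcoeff x N (Suc N)\<close>
    is 0.\<close>
  also have "\<dots> = 0" by (simp add: Q_def E_def)
  finally show ?thesis .
qed

text \<open>Over the common summand \<open>E\<close> the left-hand side is
  \<open>-(x + 3 * j + 3)\<close> times the telescoping sum for \<open>K = 2 * j + 2\<close> and
  \<open>v = x - j + 1\<close>. Where the odd sums vanish, a first-order recurrence for the even
  sums remains.\<close>

lemma even_sum_recurrence:
  fixes x N j :: nat
  defines "A \<equiv> (real x + real j + 1) * (2 * real N + real x + real j + 2) * (2 * real N + real x + 1 - real j)"
    and "B \<equiv> 2 * (real j + 1) * (2 * real N - 1 - 2 * real j) * (real N + real x + real j + 2)"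
  shows "A * (odd_sum x N j + 2 * even_sum x N j) + B * (odd_sum x N (Suc j) + 2 * even_sum x N (Suc j)) = 0"
proof -
  define n where "n i = real x + real i + real j" for i
  define u where "u i = real x - real j + 1 + 2 * real i" for i
  define E where "E i = kcoeff x N i * (fact (x + i + j) * ifact (2 * int j + 2 - int i)
    * ifact (int x - int j + 1 + 2 * int i))" for i
  have f: "fact (x + i + Suc j) = (n i + 1) * (fact (x + i + j) :: real)" for i
    by (simp add: n_def algebra_simps)
  have k: "ifact (2 * int j + 1 - int i) = (2 * real j + 2 - real i) * ifact (2 * int j + 2 - int i)"
    "ifact (2 * int j - int i) = (2 * real j + 1 - real i) * ifact (2 * int j + 1 - int i)"
    "ifact (2 * int j - 1 - int i) = (2 * real j - real i) * ifact (2 * int j - int i)" for i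
    by (rule ifact_step; simp)+
  have m: "ifact (int x - int j + 2 * int i) = u i * ifact (int x - int j + 1 + 2 * int i)"
    "ifact (int x - int j - 1 + 2 * int i) = (u i - 1) * ifact (int x - int j + 2 * int i)" for i
    by (rule ifact_step; simp add: u_def)+
  have o0: "odd_sum x N j = (\<Sum>i\<le>N. (2 * real j - real i) * (2 * real j + 1 - real i) * (2 * real j + 2 - real i) * E i)"
    unfolding odd_sum_def E_def k by (simp only: mult_ac)
  have e0: "even_sum x N j = (\<Sum>i\<le>N. (2 * real j + 1 - real i) * (2 * real j + 2 - real i) * u i * E i)"
    unfolding even_sum_def E_def k m by (simp only: mult_ac)
  have idx: "2 * int (Suc j) - 1 - int i = 2 * int j + 1 - int i"
    "int x - int (Suc j) + 1 + 2 * int i = int x - int j + 2 * int i"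
    "2 * int (Suc j) - int i = 2 * int j + 2 - int i"
    "int x - int (Suc j) + 2 * int i = int x - int j - 1 + 2 * int i" for i by simp_all
  have o1: "odd_sum x N (Suc j) = (\<Sum>i\<le>N. (n i + 1) * (2 * real j + 2 - real i) * u i * E i)"
    unfolding odd_sum_def E_def idx f k(1) m(1) by (simp only: mult_ac)
  have e1: "even_sum x N (Suc j) = (\<Sum>i\<le>N. (n i + 1) * u i * (u i - 1) * E i)"
    unfolding even_sum_def E_def idx f m by (simp only: mult_ac)
  define P where "P i = - 2 * (real N - real i) * (2 * real i + 2 * real N + 2 * real x + 3) * (real x + 1 + real i)
    * (n i + 1) * (2 * real j + 2 - real i)" for i
  define Q where "Q i = real i * (2 * real N + 1 - real i) * (real i + 2 * real N + 2 * real x + 2)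
    * u i * (u i - 1)" for i
  have "A * (odd_sum x N j + 2 * even_sum x N j) + B * (odd_sum x N (Suc j) + 2 * even_sum x N (Suc j))
    = (\<Sum>i\<le>N. (A * ((2 * real j - real i) * (2 * real j + 1 - real i) * (2 * real j + 2 - real i)
        + 2 * (2 * real j + 1 - real i) * (2 * real j + 2 - real i) * u i)
      + B * ((n i + 1) * (2 * real j + 2 - real i) * u i + 2 * (n i + 1) * u i * (u i - 1))) * E i)"
    unfolding o0 e0 o1 e1
    by (simp only: sum_distrib_left distrib_right distrib_left sum.distrib mult.assoc)
  also have "\<dots> = (\<Sum>i\<le>N. - (real x + 3 * real j + 3) * ((P i - Q i) * E i))"
  proof (rule sum.cong[OF refl])
    fix i
    have "A * ((2 * real j - real i) * (2 * real j + 1 - real i) * (2 * real j + 2 - real i)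
        + 2 * (2 * real j + 1 - real i) * (2 * real j + 2 - real i) * u i)
      + B * ((n i + 1) * (2 * real j + 2 - real i) * u i + 2 * (n i + 1) * u i * (u i - 1))
      = - (real x + 3 * real j + 3) * (P i - Q i)"
      unfolding A_def B_def P_def Q_def n_def u_def by Groebner_Basis.algebra
    then show "(A * ((2 * real j - real i) * (2 * real j + 1 - real i) * (2 * real j + 2 - real i)
        + 2 * (2 * real j + 1 - real i) * (2 * real j + 2 - real i) * u i)
      + B * ((n i + 1) * (2 * real j + 2 - real i) * u i + 2 * (n i + 1) * u i * (u i - 1))) * E i
      = - (real x + 3 * real j + 3) * ((P i - Q i) * E i)"
      by (simp only: mult.assoc)
  qed
  also have "\<dots> = - (real x + 3 * real j + 3) * (\<Sum>i\<le>N. (P i - Q i) * E i)"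
    by (rule sum_distrib_left[symmetric])
  also have "(\<Sum>i\<le>N. (P i - Q i) * E i) = 0"
    using telescoping_sum[of N x j "2 * int j + 2" "int x - int j + 1"]
    unfolding P_def Q_def E_def n_def u_def by simp
  finally show ?thesis by simp
qed

text \<open>\<open>A\<close> and \<open>B\<close> are those of \<open>even_sum_recurrence\<close>,
  so that the two recurrences together eliminate the even sums and isolate the next odd sum.\<close>

lemma odd_sum_recurrence:
  fixes x N y :: nat
  defines "A \<equiv> (real x + real y + 1) * (2 * real N + real x + real y + 2) * (2 * real N + real x + 1 - real y)"
    and "B \<equiv> 2 * (real y + 1) * (2 * real N - 1 - 2 * real y) * (real N + real x + real y + 2)"
    and "C \<equiv> - (2 * real y + 3) * (2 * real N - 2 - 2 * real y) * (2 * real y + 2 * real N + 2 * real x + 5)"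
  assumes "odd_sum x N (Suc y) = 0"
  shows "A * even_sum x N y + B * even_sum x N (Suc y) + C * odd_sum x N (Suc (Suc y)) = 0"
proof -
  define n where "n i = real x + real i + real y" for i
  define u where "u i = real x - real y + 2 * real i" for i
  define E where "E i = kcoeff x N i * (fact (x + i + y) * ifact (2 * int y + 3 - int i)
    * ifact (int x - int y + 2 * int i))" for i
  \<comment> \<open>The coefficient of the vanishing sum \<open>odd_sum x N (Suc y)\<close> in the
    certificate. It is determined by comparing the summands at \<open>i = 0\<close>; the factor
    \<open>2 * y + 2\<close> on the other terms avoids dividing \<open>D\<close> by it.\<close>
  define D where "D = - 2 * real N * (2 * real N + 2 * real x + 3) * (real x + 1) * (real x + 3 * real y + 4)
    - (2 * real N + 2 + real x + real y) * (2 * real N + real x + 1 - real y) * (2 * real y + 1) * (2 * real y + 2)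
    - B * (real x - real y)
    + (2 * real N - 2 - 2 * real y) * (2 * real y + 2 * real N + 2 * real x + 5) * (real x + real y + 2) * (real x - real y)"
  have f: "fact (x + i + Suc y) = (n i + 1) * (fact (x + i + y) :: real)"
    "fact (x + i + Suc (Suc y)) = (n i + 2) * (fact (x + i + Suc y) :: real)" for i
    by (simp_all add: n_def algebra_simps)
  have k: "ifact (2 * int y + 2 - int i) = (2 * real y + 3 - real i) * ifact (2 * int y + 3 - int i)"
    "ifact (2 * int y + 1 - int i) = (2 * real y + 2 - real i) * ifact (2 * int y + 2 - int i)"
    "ifact (2 * int y - int i) = (2 * real y + 1 - real i) * ifact (2 * int y + 1 - int i)" for i
    by (rule ifact_step; simp)+
  have m: "ifact (int x - int y - 1 + 2 * int i) = u i * ifact (int x - int y + 2 * int i)" for i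
    by (rule ifact_step; simp add: u_def)
  have idx: "2 * int (Suc y) - 1 - int i = 2 * int y + 1 - int i"
    "int x - int (Suc y) + 1 + 2 * int i = int x - int y + 2 * int i"
    "2 * int (Suc y) - int i = 2 * int y + 2 - int i"
    "int x - int (Suc y) + 2 * int i = int x - int y - 1 + 2 * int i"
    "2 * int (Suc (Suc y)) - 1 - int i = 2 * int y + 3 - int i"
    "int x - int (Suc (Suc y)) + 1 + 2 * int i = int x - int y - 1 + 2 * int i" for i by simp_all
  have e0: "even_sum x N y = (\<Sum>i\<le>N. (2 * real y + 1 - real i) * (2 * real y + 2 - real i) * (2 * real y + 3 - real i) * E i)"
    unfolding even_sum_def E_def k by (simp only: mult_ac)
  have o1: "odd_sum x N (Suc y) = (\<Sum>i\<le>N. (n i + 1) * (2 * real y + 2 - real i) * (2 * real y + 3 - real i) * E i)"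
    unfolding odd_sum_def E_def idx f k(1,2) by (simp only: mult_ac)
  have e1: "even_sum x N (Suc y) = (\<Sum>i\<le>N. (n i + 1) * (2 * real y + 3 - real i) * u i * E i)"
    unfolding even_sum_def E_def idx f k(1) m by (simp only: mult_ac)
  have o2: "odd_sum x N (Suc (Suc y)) = (\<Sum>i\<le>N. (n i + 1) * (n i + 2) * u i * E i)"
    unfolding odd_sum_def E_def idx f m by (simp only: mult_ac)
  define P where "P i = - 2 * (real N - real i) * (2 * real i + 2 * real N + 2 * real x + 3) * (real x + 1 + real i)
    * (n i + 1) * (2 * real y + 3 - real i)" for i
  define Q where "Q i = real i * (2 * real N + 1 - real i) * (real i + 2 * real N + 2 * real x + 2)
    * u i * (u i - 1)" for i
  have "(2 * real y + 2) * (A * even_sum x N y + B * even_sum x N (Suc y) + C * odd_sum x N (Suc (Suc y)))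
      + D * odd_sum x N (Suc y)
    = (\<Sum>i\<le>N. ((2 * real y + 2)
        * (A * ((2 * real y + 1 - real i) * (2 * real y + 2 - real i) * (2 * real y + 3 - real i))
          + B * ((n i + 1) * (2 * real y + 3 - real i) * u i) + C * ((n i + 1) * (n i + 2) * u i))
      + D * ((n i + 1) * (2 * real y + 2 - real i) * (2 * real y + 3 - real i))) * E i)"
    unfolding e0 o1 e1 o2
    by (simp only: sum_distrib_left distrib_right[of _ _ "E _"] distrib_left sum.distrib mult.assoc)
  also have "\<dots> = (\<Sum>i\<le>N. (2 * real y + 2) * (real x + 3 * real y + 4) * ((P i - Q i) * E i))"
  proof (rule sum.cong[OF refl])
    fix i
    have "(2 * real y + 2)
        * (A * ((2 * real y + 1 - real i) * (2 * real y + 2 - real i) * (2 * real y + 3 - real i))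
          + B * ((n i + 1) * (2 * real y + 3 - real i) * u i) + C * ((n i + 1) * (n i + 2) * u i))
      + D * ((n i + 1) * (2 * real y + 2 - real i) * (2 * real y + 3 - real i))
      = (2 * real y + 2) * (real x + 3 * real y + 4) * (P i - Q i)"
      unfolding A_def B_def C_def D_def P_def Q_def n_def u_def by Groebner_Basis.algebra
    then show "((2 * real y + 2)
        * (A * ((2 * real y + 1 - real i) * (2 * real y + 2 - real i) * (2 * real y + 3 - real i))
          + B * ((n i + 1) * (2 * real y + 3 - real i) * u i) + C * ((n i + 1) * (n i + 2) * u i))
      + D * ((n i + 1) * (2 * real y + 2 - real i) * (2 * real y + 3 - real i))) * E i
      = (2 * real y + 2) * (real x + 3 * real y + 4) * ((P i - Q i) * E i)"
      by (simp only: mult.assoc)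
  qed
  also have "\<dots> = (2 * real y + 2) * (real x + 3 * real y + 4) * (\<Sum>i\<le>N. (P i - Q i) * E i)"
    by (rule sum_distrib_left[symmetric])
  also have "(\<Sum>i\<le>N. (P i - Q i) * E i) = 0"
    using telescoping_sum[of N x y "2 * int y + 3" "int x - int y"]
    unfolding P_def Q_def E_def n_def u_def by simp
  finally have "(2 * real y + 2) * (A * even_sum x N y + B * even_sum x N (Suc y) + C * odd_sum x N (Suc (Suc y))) = 0"
    using assms(4) by simp
  moreover have "2 * real y + 2 \<noteq> 0" by linarith
  ultimately show ?thesis by (simp only: mult_eq_0_iff) simp
qed

text \<open>If two consecutive odd sums vanish, the first recurrence makes the even part of the
  second one 0, leaving \<open>?C\<close> times the next odd sum. The factor
  \<open>2 * N - 2 - 2 * y\<close> of \<open>?C\<close> is nonzero as long as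
  \<open>y + 2 \<le> N\<close>.\<close>

lemma odd_sum_eq_0: "j \<le> N \<Longrightarrow> odd_sum x N j = 0"
proof (induction j rule: induct_nat_012)
  case (ge2 y)
  then have zero: "odd_sum x N y = 0" "odd_sum x N (Suc y) = 0" by simp_all
  let ?C = "- (2 * real y + 3) * (2 * real N - 2 - 2 * real y) * (2 * real y + 2 * real N + 2 * real x + 5)"
  have "?C * odd_sum x N (Suc (Suc y)) = 0"
    using even_sum_recurrence[where j = y and x = x and N = N] odd_sum_recurrence[OF zero(2)]
    unfolding zero by (simp add: algebra_simps)
  moreover have "?C \<noteq> 0" using ge2.prems by auto
  ultimately show ?case by (simp only: mult_eq_0_iff) simp
qed (use odd_sum_0 odd_sum_1 in simp_all)

lemma even_sum_Suc:
  assumes "Suc j \<le> N"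
  shows "2 * (real j + 1) * (2 * real N - 1 - 2 * real j) * (real N + real x + real j + 2) * even_sum x N (Suc j)
    = - ((real x + real j + 1) * (2 * real N + real x + real j + 2) * (2 * real N + real x + 1 - real j)) * even_sum x N j"
proof -
  have zero: "odd_sum x N j = 0" "odd_sum x N (Suc j) = 0" using assms by (simp_all add: odd_sum_eq_0)
  have cancel: "b * e' = - a * e" if "a * (0 + 2 * e) + b * (0 + 2 * e') = 0" for a b e e' :: real
    using that by (simp add: algebra_simps)
  show ?thesis by (rule cancel) (rule even_sum_recurrence[of x j N, unfolded zero])
qed

lemma path_det_single:
  "kcoeff x N N * path_det x N [k] = path_det x N [] * even_sum x N k"
  unfolding even_sum_entry[symmetric]
  by (rule path_det_replace_row) (use odd_sum_entry odd_sum_eq_0 in simp)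

section \<open>Product formulas\<close>

text \<open>The double factorial of \<open>2 * n - 1\<close>.\<close>

definition odd_prod :: "nat \<Rightarrow> real" where
  "odd_prod n = (\<Prod>k<n. 2 * real k + 1)"

lemma odd_prod_Suc: "odd_prod (Suc n) = (2 * real n + 1) * odd_prod n"
  by (simp add: odd_prod_def)

lemma odd_prod_pos: "odd_prod n > 0"
  by (auto simp: odd_prod_def intro!: prod_pos)

lemma spoch_odd: "spoch (2 * real c + 1) (int m) = odd_prod (c + m) / odd_prod c"
proof (induction m)
  case (Suc m)
  have "spoch (2 * real c + 1) (int (Suc m)) = spoch (2 * real c + 1) (int m) * (2 * real (c + m) + 1)"
    by (simp add: spoch_def algebra_simps nat_add_distrib)
  then show ?case unfolding Suc by (simp add: odd_prod_Suc)
qed (use odd_prod_pos[of c] in \<open>simp add: spoch_def\<close>)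

text \<open>The convention for negative indices is the one under which this quotient is also right
  for \<open>q < p\<close>, so \<open>P1\<close> can be rewritten without regard to the signs of its
  indices.\<close>

lemma poch_fact: "poch (real p + 1) (int q - int p) = fact q / fact p"
proof (cases "p \<le> q")
  case True
  then obtain d where d: "q = p + d" using le_Suc_ex by blast
  have "fact p * pochhammer (real p + 1) d = fact (p + d)"
    using pochhammer_product'[of "1 :: real" p d] by (simp add: pochhammer_fact add.commute)
  then show ?thesis unfolding d by (simp add: poch_def field_simps)
next
  case False
  then obtain d where d: "p = q + d" using le_Suc_ex[of q p] by auto
  have "(\<Prod>i\<in>{1..d}. real (q + d) + 1 - real i) = fact (q + d) / fact q" for d
  proof (induction d)
    case (Suc d)
    have "(\<Prod>i\<in>{1..Suc d}. real (q + Suc d) + 1 - real i)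
      = real (q + Suc d) * (\<Prod>i\<in>{Suc 1..Suc d}. real (q + Suc d) + 1 - real i)"
      by (subst prod.atLeast_Suc_atMost) simp_all
    also have "(\<Prod>i\<in>{Suc 1..Suc d}. real (q + Suc d) + 1 - real i) = (\<Prod>i\<in>{1..d}. real (q + d) + 1 - real i)"
      by (subst prod.shift_bounds_cl_Suc_ivl) (simp add: algebra_simps)
    finally show ?case unfolding Suc by (simp add: field_simps)
  qed simp
  moreover have "0 < d" using False d by simp
  ultimately show ?thesis unfolding d by (simp add: poch_def)
qed

text \<open>The factor with index \<open>i + 1\<close> of the first product in \<open>P1\<close>, for \<open>a = 0\<close>.\<close>

definition tri_factor :: "nat \<Rightarrow> nat \<Rightarrow> real" where
  "tri_factor x i = fact (2 * x + 3 * i + 2) * fact i * odd_prod (x + 3 * i + 2) * odd_prod (x + i + 1)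
    / (2 * fact (2 * x + 2 * i + 1) * fact (2 * i + 1) * odd_prod (x + 2 * i + 2) * odd_prod (x + 2 * i + 1))"

definition tri_prod :: "nat \<Rightarrow> nat \<Rightarrow> real" where
  "tri_prod x n = (\<Prod>i<n. tri_factor x i)"

lemma tri_factor_pos: "tri_factor x i > 0"
  by (simp add: tri_factor_def odd_prod_pos)

lemma tri_prod_pos: "tri_prod x n > 0"
  by (auto simp: tri_prod_def intro!: prod_pos tri_factor_pos)

lemma tri_factor_eq:
  "tri_factor x i = 1 / 2 * (poch (2 * real x + 2 * real (Suc i)) (int (Suc i))
    * spoch (2 * real x + 4 * real (Suc i) + 1) (int (Suc i) - 1)
    / (poch (real (Suc i)) (int (Suc i)) * spoch (2 * real x + 2 * real (Suc i) + 1) (int (Suc i) - 1)))"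
proof -
  have "poch (2 * real x + 2 * real (Suc i)) (int (Suc i)) = fact (2 * x + 3 * i + 2) / fact (2 * x + 2 * i + 1)"
    using poch_fact[of "2 * x + 2 * i + 1" "2 * x + 3 * i + 2"] by (simp add: algebra_simps)
  moreover have "poch (real (Suc i)) (int (Suc i)) = fact (2 * i + 1) / fact i"
    using poch_fact[of i "2 * i + 1"] by (simp add: algebra_simps)
  moreover have "spoch (2 * real x + 4 * real (Suc i) + 1) (int (Suc i) - 1) = odd_prod (x + 3 * i + 2) / odd_prod (x + 2 * i + 2)"
  proof -
    have "2 * real x + 4 * real (Suc i) + 1 = 2 * real (x + 2 * i + 2) + 1" "int (Suc i) - 1 = int i"
      "x + 3 * i + 2 = x + 2 * i + 2 + i" by simp_all
    then show ?thesis by (simp only: spoch_odd)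
  qed
  moreover have "spoch (2 * real x + 2 * real (Suc i) + 1) (int (Suc i) - 1) = odd_prod (x + 2 * i + 1) / odd_prod (x + i + 1)"
  proof -
    have "2 * real x + 2 * real (Suc i) + 1 = 2 * real (x + i + 1) + 1" "int (Suc i) - 1 = int i"
      "x + 2 * i + 1 = x + i + 1 + i" by simp_all
    then show ?thesis by (simp only: spoch_odd)
  qed
  ultimately show ?thesis by (simp only: tri_factor_def) (simp add: field_simps)
qed

section \<open>The determinant without a hole\<close>

text \<open>The absolute value of \<open>kcoeff x N N\<close>.\<close>

definition kcoeff_last :: "nat \<Rightarrow> nat \<Rightarrow> real" where
  "kcoeff_last x N = 2 ^ N * fact N * fact (x + N) * odd_prod (2 * N + x + 1) * fact (2 * N + 2 * x + 2)
    / (fact x * odd_prod (N + x + 1) * fact (2 * N) * fact (3 * N + 2 * x + 2))"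

lemma kcoeff_eq:
  assumes "i \<le> N"
  shows "kcoeff x N i = (- 2) ^ i * fact N * fact (x + i) * odd_prod (N + x + 1 + i) * fact (2 * N - i) * fact (2 * N + 2 * x + 2)
    / (fact (N - i) * fact x * odd_prod (N + x + 1) * fact i * fact (2 * N) * fact (2 * N + 2 * x + 2 + i))"
  using assms
proof (induction i)
  case 0
  show ?case using odd_prod_pos[of "N + x + 1"] by simp
next
  case (Suc i)
  have d: "fact (N - i) = (real N - real i) * fact (N - Suc i)"
    "fact (2 * N - i) = (2 * real N - real i) * fact (2 * N - Suc i)"
    using Suc.prems by (simp_all add: fact_reduce[of "N - i"] fact_reduce[of "2 * N - i"] of_nat_diff)
  have u: "fact (x + Suc i) = (real x + 1 + real i) * fact (x + i)"
    "odd_prod (N + x + 1 + Suc i) = (2 * real i + 2 * real N + 2 * real x + 3) * odd_prod (N + x + 1 + i)"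
    "fact (2 * N + 2 * x + 2 + Suc i) = (real i + 2 * real N + 2 * real x + 3) * fact (2 * N + 2 * x + 2 + i)"
    "fact (Suc i) = (real i + 1) * fact i"
    by (simp_all add: odd_prod_Suc algebra_simps)
  have nz: "real N - real i \<noteq> 0" "2 * real N - real i \<noteq> 0" "real i + 1 \<noteq> 0"
    "real i + 2 * real N + 2 * real x + 3 \<noteq> 0"
    using Suc.prems by simp_all
  have cancel: "p * F * X * O' * (m * D) * G / (n * M * x' * o' * I * T * W) * (- 2 * n * s * t) / (k * m * w)
      = - 2 * p * F * (t * X) * (s * O') * D * G / (M * x' * o' * (k * I) * T * (w * W))"
    if "n \<noteq> 0" "m \<noteq> 0" "k \<noteq> 0" "w \<noteq> 0" for p F X O' D G M x' o' I T W s t n m k w :: real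
    using that by (simp add: mult_ac)
  have "kcoeff x N i = (- 2) ^ i * fact N * fact (x + i) * odd_prod (N + x + 1 + i) * fact (2 * N - i) * fact (2 * N + 2 * x + 2)
    / (fact (N - i) * fact x * odd_prod (N + x + 1) * fact i * fact (2 * N) * fact (2 * N + 2 * x + 2 + i))"
    using Suc by simp
  then have IH: "kcoeff x N i = (- 2) ^ i * fact N * fact (x + i) * odd_prod (N + x + 1 + i)
      * ((2 * real N - real i) * fact (2 * N - Suc i)) * fact (2 * N + 2 * x + 2)
    / ((real N - real i) * fact (N - Suc i) * fact x * odd_prod (N + x + 1) * fact i * fact (2 * N) * fact (2 * N + 2 * x + 2 + i))"
    unfolding d .
  show ?case
    unfolding kcoeff.simps IH u power_Suc
    by (rule cancel[OF nz])
qed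

lemma kcoeff_last: "kcoeff x N N = (-1) ^ N * kcoeff_last x N"
proof -
  have "(- 2 :: real) ^ N = (-1) ^ N * 2 ^ N" by (simp add: power_mult_distrib[symmetric])
  moreover have "N + x + 1 + N = 2 * N + x + 1" "2 * N + 2 * x + 2 + N = 3 * N + 2 * x + 2" "2 * N - N = N"
    by simp_all
  ultimately show ?thesis
    unfolding kcoeff_eq[OF order_refl] kcoeff_last_def by (simp only: diff_self_eq_0 fact_0) (simp add: mult_ac)
qed

lemma kcoeff_last_pos: "kcoeff_last x N > 0"
  by (simp add: kcoeff_last_def odd_prod_pos)

text \<open>The induction step of \<open>tri_prod_kcoeff_last\<close>, as a statement about
  quotients of consecutive terms.\<close>

lemma tri_factor_kcoeff_last:
  "tri_factor x (Suc i) * kcoeff_last x (Suc i) = kcoeff_last x (Suc (Suc i)) * tri_factor (x + 3) i"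
proof -
  define i1 i2 i3 X2 w :: real where "i1 = real i + 1" and "i2 = real i + 2" and "i3 = 2 * real i + 3"
    and "X2 = real x + real i + 2" and "w = 2 * real x + 2 * real i + 7"
  \<comment> \<open>Factorials and double factorials become plain variables here, so that only the
    few linear factors by which they differ remain to be cancelled.\<close>
  have cancel: "(A * (i1 * f) * P * Q) / (2 * a * (i3 * (2 * i1 * t)) * R * S)
      * (p * (i1 * f) * F * S * (2 * X2 * a) / (y * Q * (2 * i1 * t) * A))
    = 2 * p * (i2 * (i1 * f)) * (X2 * F) * U * g / (y * V * (2 * i2 * (i3 * (2 * i1 * t))) * h)
      * (h * f * P * (w * V) / (2 * (w * g) * t * U * R))"
    if "A > 0" "Q > 0" "a > 0" "t > 0" "R > 0" "S > 0" "y > 0" "U > 0" "g > 0" "V > 0" "h > 0"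
    for A f P Q a t R S p F y U g V h :: real
  proof -
    have "i1 > 0" "i2 > 0" "i3 > 0" "w > 0" by (simp_all add: i1_def i2_def i3_def w_def)
    then show ?thesis using that by (simp add: field_simps)
  qed
  have "tri_factor x (Suc i) = (fact (2 * x + 3 * i + 5) * (i1 * fact i) * odd_prod (x + 3 * i + 5) * odd_prod (x + i + 2))
      / (2 * fact (2 * x + 2 * i + 3) * (i3 * (2 * i1 * fact (2 * i + 1))) * odd_prod (x + 2 * i + 4) * odd_prod (x + 2 * i + 3))"
  proof -
    have "fact (2 * Suc i + 1) = i3 * (2 * i1 * (fact (2 * i + 1) :: real))" "fact (Suc i) = i1 * (fact i :: real)"
      by (simp_all add: i1_def i3_def algebra_simps)
    moreover have "2 * x + 3 * Suc i + 2 = 2 * x + 3 * i + 5" "x + 3 * Suc i + 2 = x + 3 * i + 5"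
      "x + Suc i + 1 = x + i + 2" "2 * x + 2 * Suc i + 1 = 2 * x + 2 * i + 3"
      "x + 2 * Suc i + 2 = x + 2 * i + 4" "x + 2 * Suc i + 1 = x + 2 * i + 3" by simp_all
    ultimately show ?thesis by (simp only: tri_factor_def)
  qed
  moreover have "kcoeff_last x (Suc i) = 2 ^ Suc i * (i1 * fact i) * fact (x + i + 1) * odd_prod (x + 2 * i + 3)
      * (2 * X2 * fact (2 * x + 2 * i + 3))
      / (fact x * odd_prod (x + i + 2) * (2 * i1 * fact (2 * i + 1)) * fact (2 * x + 3 * i + 5))"
  proof -
    have "fact (2 * Suc i) = 2 * i1 * (fact (2 * i + 1) :: real)" "fact (Suc i) = i1 * (fact i :: real)"
      "fact (2 * Suc i + 2 * x + 2) = 2 * X2 * (fact (2 * x + 2 * i + 3) :: real)"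
      by (simp_all add: i1_def X2_def algebra_simps fact_numeral numeral_3_eq_3)
    moreover have "x + Suc i = x + i + 1" "2 * Suc i + x + 1 = x + 2 * i + 3" "Suc i + x + 1 = x + i + 2"
      "3 * Suc i + 2 * x + 2 = 2 * x + 3 * i + 5" by simp_all
    ultimately show ?thesis by (simp only: kcoeff_last_def)
  qed
  moreover have "kcoeff_last x (Suc (Suc i)) = 2 * 2 ^ Suc i * (i2 * (i1 * fact i)) * (X2 * fact (x + i + 1))
      * odd_prod (x + 2 * i + 5) * fact (2 * x + 2 * i + 6)
      / (fact x * odd_prod (x + i + 3) * (2 * i2 * (i3 * (2 * i1 * fact (2 * i + 1)))) * fact (2 * x + 3 * i + 8))"
  proof -
    have "fact (2 * Suc (Suc i)) = 2 * i2 * (i3 * (2 * i1 * (fact (2 * i + 1) :: real)))"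
      "fact (Suc (Suc i)) = i2 * (i1 * (fact i :: real))"
      "fact (x + Suc (Suc i)) = X2 * (fact (x + i + 1) :: real)"
      by (simp_all add: i1_def i2_def i3_def X2_def algebra_simps)
    moreover have "2 * Suc (Suc i) + x + 1 = x + 2 * i + 5" "2 * Suc (Suc i) + 2 * x + 2 = 2 * x + 2 * i + 6"
      "Suc (Suc i) + x + 1 = x + i + 3" "3 * Suc (Suc i) + 2 * x + 2 = 2 * x + 3 * i + 8" by simp_all
    ultimately show ?thesis by (simp only: kcoeff_last_def power_Suc)
  qed
  moreover have "tri_factor (x + 3) i = fact (2 * x + 3 * i + 8) * fact i * odd_prod (x + 3 * i + 5) * (w * odd_prod (x + i + 3))
      / (2 * (w * fact (2 * x + 2 * i + 6)) * fact (2 * i + 1) * odd_prod (x + 2 * i + 5) * odd_prod (x + 2 * i + 4))"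
  proof -
    have "fact (2 * (x + 3) + 2 * i + 1) = w * (fact (2 * x + 2 * i + 6) :: real)"
      using fact_Suc[of "2 * x + 2 * i + 6", where 'a = real] by (simp add: w_def add.commute)
    moreover have "odd_prod (x + 3 + i + 1) = w * odd_prod (x + i + 3)"
      using odd_prod_Suc[of "x + i + 3"] by (simp add: w_def algebra_simps)
    moreover have "2 * (x + 3) + 3 * i + 2 = 2 * x + 3 * i + 8" "x + 3 + 3 * i + 2 = x + 3 * i + 5"
      "x + 3 + 2 * i + 2 = x + 2 * i + 5" "x + 3 + 2 * i + 1 = x + 2 * i + 4" by simp_all
    ultimately show ?thesis by (simp only: tri_factor_def)
  qed
  ultimately show ?thesis
    by (simp only:) (rule cancel; simp add: odd_prod_pos)
qed

lemma tri_prod_kcoeff_last: "tri_prod x (Suc n) = kcoeff_last x (Suc n) * tri_prod (x + 3) n"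
proof (induction n)
  case 0
  show ?case
  proof -
    have f: "fact (2 * x + 2) = (2 * real x + 2) * (fact (2 * x + 1) :: real)"
      "fact (2 * x + 5) = (2 * real x + 5) * (fact (2 * x + 4) :: real)"
      "fact (x + 1) = (real x + 1) * (fact x :: real)"
      "odd_prod (x + 3) = (2 * real x + 5) * odd_prod (x + 2)"
      using fact_Suc[of "2 * x + 1", where 'a = real] fact_Suc[of "2 * x + 4", where 'a = real]
        odd_prod_Suc[of "x + 2"] by (simp_all add: add_ac numeral_3_eq_3)
    have "tri_prod x (Suc 0) = fact (2 * x + 2) * odd_prod (x + 2) * odd_prod (x + 1)
        / (2 * fact (2 * x + 1) * odd_prod (x + 2) * odd_prod (x + 1))"
      by (simp add: tri_prod_def tri_factor_def)
    also have "\<dots> = real x + 1"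
      unfolding f(1) using odd_prod_pos[of "x + 1"] odd_prod_pos[of "x + 2"] by (simp add: divide_simps)
    also have "\<dots> = 2 * fact (x + 1) * odd_prod (x + 3) * fact (2 * x + 4) / (fact x * odd_prod (x + 2) * 2 * fact (2 * x + 5))"
    proof -
      have "2 * real x + 5 > 0" by linarith
      then show ?thesis unfolding f using odd_prod_pos[of "x + 2"] by (simp add: divide_simps del: fact_Suc)
    qed
    also have "\<dots> = kcoeff_last x (Suc 0)"
    proof -
      have idx: "2 * Suc 0 + x + 1 = x + 3" "2 * Suc 0 + 2 * x + 2 = 2 * x + 4" "Suc 0 + x + 1 = x + 2"
        "3 * Suc 0 + 2 * x + 2 = 2 * x + 5" "x + Suc 0 = x + 1" by simp_all
      have "fact (2 * Suc 0) = (2 :: real)" "fact (Suc 0) = (1 :: real)" "(2 :: real) ^ Suc 0 = 2" by simp_all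
      then show ?thesis unfolding kcoeff_last_def idx by (simp only: mult_1 mult_1_right mult_ac)
    qed
    finally show ?thesis by (simp add: tri_prod_def)
  qed
next
  case (Suc n)
  have "tri_prod x (Suc (Suc n)) = kcoeff_last x (Suc n) * tri_prod (x + 3) n * tri_factor x (Suc n)"
    unfolding Suc[symmetric] by (simp add: tri_prod_def)
  also have "\<dots> = kcoeff_last x (Suc (Suc n)) * (tri_prod (x + 3) n * tri_factor (x + 3) n)"
    using tri_factor_kcoeff_last[of x n] by (simp add: mult_ac)
  finally show ?case by (simp add: tri_prod_def)
qed

text \<open>In column 0 the even sum is 1, so the recursion lowers \<open>N\<close> by 1, raises
  \<open>x\<close> by 3 and contributes the factor \<open>kcoeff_last\<close>.
  \<open>tri_prod\<close> obeys the same recursion.\<close>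

lemma path_det_Nil: "path_det x N [] = tri_prod x N"
proof (induction N arbitrary: x)
  case 0
  show ?case by (simp add: path_det_def tri_prod_def)
next
  case (Suc N)
  have "path_det x (Suc N) [] = kcoeff x (Suc N) (Suc N) * path_det x (Suc N) [0]"
    by (simp only: path_det_single even_sum_0)
  then have "\<bar>path_det x (Suc N) []\<bar> = kcoeff_last x (Suc N) * \<bar>path_det x (Suc N) [0]\<bar>"
    using kcoeff_last_pos[of x "Suc N"] by (simp only: kcoeff_last abs_mult) simp
  also have "\<bar>path_det x (Suc N) [0]\<bar> = tri_prod (x + 3) N"
    using path_det_0_Cons[of x N "[]"] tri_prod_pos[of "x + 3" N] Suc by simp
  finally show ?case
    using path_det_nonneg[of x "Suc N"] by (simp add: tri_prod_kcoeff_last)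
qed

section \<open>The factor contributed by the hole\<close>

definition step_prod :: "nat \<Rightarrow> nat \<Rightarrow> nat \<Rightarrow> real" where
  "step_prod s d n = (\<Prod>k<n. fact (s + d * k))"

lemma step_prod_pos: "step_prod s d n > 0"
  by (auto simp: step_prod_def intro!: prod_pos)

lemma step_prod_0 [simp]: "step_prod s d 0 = 1"
  by (simp add: step_prod_def)

lemma step_prod_1: "step_prod s d 1 = fact s"
  by (simp add: step_prod_def)

lemma step_prod_Suc: "step_prod s d (Suc n) = step_prod s d n * fact (s + d * n)"
  by (simp add: step_prod_def)

lemma step_prod_Suc': "step_prod s d (Suc n) = fact s * step_prod (s + d) d n"
  unfolding step_prod_def by (subst prod.lessThan_Suc_shift) (simp add: algebra_simps)

text \<open>The second product in \<open>P1\<close>, with every Pochhammer symbol written as a quotient of factorials.\<close>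

definition hole_factor :: "nat \<Rightarrow> nat \<Rightarrow> nat \<Rightarrow> nat \<Rightarrow> real" where
  "hole_factor x y z a =
     (step_prod (y + z) 1 a / step_prod z 1 a)
     * (step_prod (x + 3 * y + 2 * z + 2 * a + 1) 2 a / step_prod (x + y + 2 * z + 2 * a + 1) 2 a)
     * (step_prod (x + y) 2 a / step_prod x 3 a)
     * (step_prod (x + 3 * y) 3 a / step_prod (x + 3 * y) 2 a)
     * (step_prod 0 1 a / step_prod y 1 a)
     * (step_prod (2 * z + 1) 2 a / step_prod (2 * y + 2 * z + 1) 2 a)
     * (step_prod (x + y + z + 2 * a) 1 a / step_prod (x + 2 * y + z + 2 * a) 1 a)"

lemma hole_factor_pos: "hole_factor x y z a > 0"
  by (simp add: hole_factor_def step_prod_pos)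

lemma hole_factor_y_0: "hole_factor x 0 z a = 1"
  using step_prod_pos[THEN less_imp_neq] by (simp add: hole_factor_def)

lemma hole_factor_a_0: "hole_factor x y z 0 = 1"
  by (simp add: hole_factor_def)

text \<open>For fixed \<open>N\<close>, raising \<open>y\<close> lowers \<open>z\<close>. Both sides
  then change by the same quotient, \<open>-(a * b * c) / (2 * d * e * g)\<close> in the notation of
  the proof.\<close>

lemma even_sum_hole_factor:
  assumes "N = Suc (y + z)"
  shows "even_sum x N y = (-1) ^ y * hole_factor x y z 1"
  using assms
proof (induction y arbitrary: z)
  case 0
  then show ?case by (simp add: even_sum_0 hole_factor_y_0)
next
  case (Suc y)
  have IH: "even_sum x N y = (-1) ^ y * hole_factor x y (Suc z) 1" using Suc by simp
  define a b c where "a = real x + real y + 1" and "b = 2 * real N + real x + real y + 2"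
    and "c = 2 * real N + real x + 1 - real y"
  define d e g where "d = real y + 1" and "e = 2 * real N - 1 - 2 * real y" and "g = real N + real x + real y + 2"
  have pos: "d > 0" "e > 0" "g > 0" using Suc.prems by (simp_all add: d_def e_def g_def)
  have rec: "2 * d * e * g * even_sum x N (Suc y) = - (a * b * c) * even_sum x N y"
    unfolding a_def b_def c_def d_def e_def g_def by (rule even_sum_Suc) (use Suc.prems in simp)
  have ratio: "2 * d * e * g * hole_factor x (Suc y) z 1 = a * b * c * hole_factor x y (Suc z) 1"
  proof -
    have H1: "hole_factor x y z 1 = fact (y + z) / fact z * (fact (x + 3 * y + 2 * z + 3) / fact (x + y + 2 * z + 3))
      * (fact (x + y) / fact x) * (1 / fact y) * (fact (2 * z + 1) / fact (2 * y + 2 * z + 1))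
      * (fact (x + y + z + 2) / fact (x + 2 * y + z + 2))" for y z
    proof -
      have idx: "x + 3 * y + 2 * z + 2 * 1 + 1 = x + 3 * y + 2 * z + 3"
        "x + y + 2 * z + 2 * 1 + 1 = x + y + 2 * z + 3" "x + y + z + 2 * 1 = x + y + z + 2"
        "x + 2 * y + z + 2 * 1 = x + 2 * y + z + 2" by simp_all
      have "fact (x + 3 * y) / fact (x + 3 * y) = (1 :: real)" by simp
      then show ?thesis unfolding hole_factor_def step_prod_1 idx by (simp only: mult_1_right fact_0)
    qed
    have idx: "Suc y + z = y + Suc z" "x + 3 * Suc y + 2 * z + 3 = Suc (x + 3 * y + 2 * Suc z + 3)"
      "x + y + 2 * Suc z + 3 = Suc (x + Suc y + 2 * z + 3)" "x + Suc y = Suc (x + y)"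
      "2 * Suc z + 1 = Suc (Suc (2 * z + 1))" "2 * Suc y + 2 * z + 1 = 2 * y + 2 * Suc z + 1"
      "Suc (x + y) + z + 2 = x + y + Suc z + 2" "x + 2 * Suc y + z + 2 = Suc (x + 2 * y + Suc z + 2)"
      by simp_all
    have f: "fact (Suc (x + 3 * y + 2 * Suc z + 3)) = b * (fact (x + 3 * y + 2 * Suc z + 3) :: real)"
      "fact (Suc (Suc (x + y) + 2 * z + 3)) = c * (fact (Suc (x + y) + 2 * z + 3) :: real)"
      "fact (Suc (x + y)) = a * (fact (x + y) :: real)"
      "fact (Suc (Suc (2 * z + 1))) = e * (2 * (real z + 1)) * (fact (2 * z + 1) :: real)"
      "fact (Suc (x + 2 * y + Suc z + 2)) = g * (fact (x + 2 * y + Suc z + 2) :: real)"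
      "fact (Suc y) = d * (fact y :: real)" "fact (Suc z) = (real z + 1) * (fact z :: real)"
      unfolding a_def b_def c_def d_def e_def g_def fact_Suc using Suc.prems by (simp_all del: fact_Suc add: algebra_simps)
    have cancel: "2 * d * e * g * (A / Z * (b * B / K) * (a * L / X) * (1 / (d * Y)) * (E / F) * (G / (g * P)))
      = a * b * c * (A / (z' * Z) * (B / (c * K)) * (L / X) * (1 / Y) * (e * (2 * z') * E / F) * (G / P))"
      if "z' > 0" "c > 0" for A Z B K L X Y E F G P z' :: real
      using that pos by simp
    show ?thesis
      unfolding H1 idx f by (rule cancel) (simp_all add: c_def Suc.prems)
  qed
  have "2 * d * e * g * even_sum x N (Suc y) = 2 * d * e * g * ((-1) ^ Suc y * hole_factor x (Suc y) z 1)"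
    unfolding rec IH using ratio by (simp add: mult_ac)
  moreover have "2 * d * e * g \<noteq> 0" using pos by simp
  ultimately show ?case using mult_left_cancel by blast
qed

text \<open>This and the next four lemmas compare two products of length \<open>b + 1\<close> with
  products of lengths \<open>b + 2\<close> and \<open>b\<close>, as needed for condensation. Here
  the starting values are the same, and the last factorials that change sides are equal; the two
  lemmas after it allow them to differ by one factor. The disjunction admits either order.\<close>

lemma step_prod_last_eq:
  assumes "s' = s \<and> t' = t \<or> s' = t \<and> t' = s" "s + d * Suc b = t + d * b"
  shows "step_prod s' d (Suc b) * step_prod t' d (Suc b) = step_prod s d (b + 2) * step_prod t d b"
proof -
  have "step_prod s d (b + 2) = step_prod s d (Suc b) * fact (t + d * b)"
    using step_prod_Suc[of s d "Suc b"] by (simp only: assms(2) add_2_eq_Suc')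
  then show ?thesis using assms(1) by (auto simp: step_prod_Suc)
qed

lemma step_prod_last_div:
  assumes "s' = s \<and> t' = t \<or> s' = t \<and> t' = s" "s + d * Suc b = Suc (t + d * b)" "r = real (Suc (t + d * b))"
  shows "step_prod s' d (Suc b) * step_prod t' d (Suc b) = step_prod s d (b + 2) * step_prod t d b / r"
proof -
  have "step_prod s d (b + 2) = step_prod s d (Suc b) * (r * fact (t + d * b))"
    using step_prod_Suc[of s d "Suc b"] by (simp only: assms(2,3) add_2_eq_Suc' fact_Suc of_nat_mult)
  moreover have "r > 0" unfolding assms(3) of_nat_0_less_iff by simp
  ultimately show ?thesis using assms(1) by (auto simp: step_prod_Suc)
qed

lemma step_prod_last_mult:
  assumes "s' = s \<and> t' = t \<or> s' = t \<and> t' = s" "Suc (s + d * Suc b) = t + d * b" "r = real (t + d * b)"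
  shows "step_prod s' d (Suc b) * step_prod t' d (Suc b) = step_prod s d (b + 2) * step_prod t d b * r"
proof -
  have "fact (t + d * b) = r * fact (s + d * Suc b)"
    unfolding assms(3) by (simp only: assms(2)[symmetric] fact_Suc)
  then have "step_prod t d (Suc b) = step_prod t d b * (r * fact (s + d * Suc b))"
    by (simp only: step_prod_Suc)
  moreover have "step_prod s d (b + 2) = step_prod s d (Suc b) * fact (s + d * Suc b)"
    using step_prod_Suc[of s d "Suc b"] by simp
  ultimately show ?thesis using assms(1) by auto
qed

text \<open>The starting values are moved by \<open>d\<close>, so here the first factorials change
  sides.\<close>

lemma step_prod_first_div:
  assumes "s' = s + d \<and> t' + d = t \<and> s = Suc t' \<or> t' = s + d \<and> s' + d = t \<and> s = Suc s'" "r = real s"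
  shows "step_prod s' d (Suc b) * step_prod t' d (Suc b) = step_prod s d (b + 2) * step_prod t d b / r"
proof -
  have "step_prod (s + d) d (Suc b) * step_prod u d (Suc b) = step_prod s d (b + 2) * step_prod (u + d) d b / r"
    if "s = Suc u" for u
    using that assms(2) step_prod_Suc'[of s d "Suc b"] by (simp add: step_prod_Suc'[of u])
  then show ?thesis using assms(1) by (metis mult.commute)
qed

lemma step_prod_first_mult:
  assumes "s' = s + d \<and> t' + d = t \<and> t' = Suc s \<or> t' = s + d \<and> s' + d = t \<and> s' = Suc s" "r = real (Suc s)"
  shows "step_prod s' d (Suc b) * step_prod t' d (Suc b) = step_prod s d (b + 2) * step_prod t d b * r"
proof -
  have "step_prod (s + d) d (Suc b) * step_prod u d (Suc b) = step_prod s d (b + 2) * step_prod (u + d) d b * r"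
    if "u = Suc s" for u
  proof -
    have "step_prod u d (Suc b) = r * fact s * step_prod (u + d) d b"
      unfolding step_prod_Suc'[of u] by (simp only: that assms(2) fact_Suc)
    then show ?thesis using step_prod_Suc'[of s d "Suc b"] by simp
  qed
  then show ?thesis using assms(1) by (metis mult.commute)
qed

text \<open>Relative to the left-hand side, each product on the right is a quotient of linear
  factors, both with the same denominator. What remains is a polynomial identity. The value of
  \<open>y\<close> is written \<open>Suc w\<close> because the subtracted product contains
  \<open>y - 1\<close>.\<close>

lemma hole_factor_condensation:
  "hole_factor x (Suc w) z (b + 2) * hole_factor (x + 3) (Suc w) (Suc z) b
    = hole_factor (x + 3) (Suc w) z (Suc b) * hole_factor x (Suc w) (Suc z) (Suc b)
      - hole_factor (x + 3) w (Suc z) (Suc b) * hole_factor x (Suc (Suc w)) z (Suc b)"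
proof -
  define X Y Z B where "X = real x" and "Y = real w + 1" and "Z = real z" and "B = real b"
  define p q c e where "p = X + 3 * Y + 2 * Z + 2 * B" and "q = X + Y + 2 * Z + 2 * B"
    and "c = X + Y + Z + 2 * B" and "e = X + 2 * Y + Z + 2 * B"
  note defs = X_def Y_def Z_def B_def p_def q_def c_def e_def
  define L1 where "L1 = step_prod (Suc w + z) 1 (b + 2)
    * step_prod (Suc w + Suc z) 1 b"
  define L2 where "L2 = step_prod (z) 1 (b + 2)
    * step_prod (Suc z) 1 b"
  define L3 where "L3 = step_prod (x + 3 * Suc w + 2 * z + 2 * (b + 2) + 1) 2 (b + 2)
    * step_prod ((x + 3) + 3 * Suc w + 2 * Suc z + 2 * b + 1) 2 b"
  define L4 where "L4 = step_prod (x + Suc w + 2 * z + 2 * (b + 2) + 1) 2 (b + 2)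
    * step_prod ((x + 3) + Suc w + 2 * Suc z + 2 * b + 1) 2 b"
  define L5 where "L5 = step_prod (x + Suc w) 2 (b + 2)
    * step_prod ((x + 3) + Suc w) 2 b"
  define L6 where "L6 = step_prod (x) 3 (b + 2)
    * step_prod ((x + 3)) 3 b"
  define L7 where "L7 = step_prod (x + 3 * Suc w) 3 (b + 2)
    * step_prod ((x + 3) + 3 * Suc w) 3 b"
  define L8 where "L8 = step_prod (x + 3 * Suc w) 2 (b + 2)
    * step_prod ((x + 3) + 3 * Suc w) 2 b"
  define L9 where "L9 = step_prod (0) 1 (b + 2)
    * step_prod (0) 1 b"
  define L10 where "L10 = step_prod (Suc w) 1 (b + 2)
    * step_prod (Suc w) 1 b"
  define L11 where "L11 = step_prod (2 * z + 1) 2 (b + 2)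
    * step_prod (2 * Suc z + 1) 2 b"
  define L12 where "L12 = step_prod (2 * Suc w + 2 * z + 1) 2 (b + 2)
    * step_prod (2 * Suc w + 2 * Suc z + 1) 2 b"
  define L13 where "L13 = step_prod (x + Suc w + z + 2 * (b + 2)) 1 (b + 2)
    * step_prod ((x + 3) + Suc w + Suc z + 2 * b) 1 b"
  define L14 where "L14 = step_prod (x + 2 * Suc w + z + 2 * (b + 2)) 1 (b + 2)
    * step_prod ((x + 3) + 2 * Suc w + Suc z + 2 * b) 1 b"
  note L_defs = L1_def L2_def L3_def L4_def L5_def L6_def L7_def L8_def L9_def L10_def L11_def L12_def L13_def L14_def
  have R1: "step_prod (Suc w + z) 1 (Suc b)
    * step_prod (Suc w + Suc z) 1 (Suc b) = L1"
    unfolding L1_def by (rule step_prod_last_eq; simp add: defs)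
  have R2: "step_prod (z) 1 (Suc b)
    * step_prod (Suc z) 1 (Suc b) = L2"
    unfolding L2_def by (rule step_prod_last_eq; simp add: defs)
  have R3: "step_prod ((x + 3) + 3 * Suc w + 2 * z + 2 * Suc b + 1) 2 (Suc b)
    * step_prod (x + 3 * Suc w + 2 * Suc z + 2 * Suc b + 1) 2 (Suc b) = L3 / (p + 2 * B + 7)"
    unfolding L3_def by (rule step_prod_last_div; simp add: defs)
  have R4: "step_prod ((x + 3) + Suc w + 2 * z + 2 * Suc b + 1) 2 (Suc b)
    * step_prod (x + Suc w + 2 * Suc z + 2 * Suc b + 1) 2 (Suc b) = L4 / (q + 2 * B + 7)"
    unfolding L4_def by (rule step_prod_last_div; simp add: defs)
  have R5: "step_prod ((x + 3) + Suc w) 2 (Suc b)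
    * step_prod (x + Suc w) 2 (Suc b) = L5 * (X + Y + 2 * B + 3)"
    unfolding L5_def by (rule step_prod_last_mult; simp add: defs)
  have R6: "step_prod ((x + 3)) 3 (Suc b)
    * step_prod (x) 3 (Suc b) = L6"
    unfolding L6_def by (rule step_prod_last_eq; simp add: defs)
  have R7: "step_prod ((x + 3) + 3 * Suc w) 3 (Suc b)
    * step_prod (x + 3 * Suc w) 3 (Suc b) = L7"
    unfolding L7_def by (rule step_prod_last_eq; simp add: defs)
  have R8: "step_prod ((x + 3) + 3 * Suc w) 2 (Suc b)
    * step_prod (x + 3 * Suc w) 2 (Suc b) = L8 * (X + 3 * Y + 2 * B + 3)"
    unfolding L8_def by (rule step_prod_last_mult; simp add: defs)
  have R9: "step_prod (0) 1 (Suc b)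
    * step_prod (0) 1 (Suc b) = L9 / (B + 1)"
    unfolding L9_def by (rule step_prod_last_div; simp add: defs)
  have R10: "step_prod (Suc w) 1 (Suc b)
    * step_prod (Suc w) 1 (Suc b) = L10 / (Y + B + 1)"
    unfolding L10_def by (rule step_prod_last_div; simp add: defs)
  have R11: "step_prod (2 * z + 1) 2 (Suc b)
    * step_prod (2 * Suc z + 1) 2 (Suc b) = L11"
    unfolding L11_def by (rule step_prod_last_eq; simp add: defs)
  have R12: "step_prod (2 * Suc w + 2 * z + 1) 2 (Suc b)
    * step_prod (2 * Suc w + 2 * Suc z + 1) 2 (Suc b) = L12"
    unfolding L12_def by (rule step_prod_last_eq; simp add: defs)
  have R13: "step_prod ((x + 3) + Suc w + z + 2 * Suc b) 1 (Suc b)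
    * step_prod (x + Suc w + Suc z + 2 * Suc b) 1 (Suc b) = L13 / (c + 4)"
    unfolding L13_def by (rule step_prod_first_div; simp add: defs)
  have R14: "step_prod ((x + 3) + 2 * Suc w + z + 2 * Suc b) 1 (Suc b)
    * step_prod (x + 2 * Suc w + Suc z + 2 * Suc b) 1 (Suc b) = L14 / (e + 4)"
    unfolding L14_def by (rule step_prod_first_div; simp add: defs)
  have S1: "step_prod (w + Suc z) 1 (Suc b)
    * step_prod (Suc (Suc w) + z) 1 (Suc b) = L1"
    unfolding L1_def by (rule step_prod_last_eq; simp add: defs)
  have S2: "step_prod (Suc z) 1 (Suc b)
    * step_prod (z) 1 (Suc b) = L2"
    unfolding L2_def by (rule step_prod_last_eq; simp add: defs)
  have S3: "step_prod ((x + 3) + 3 * w + 2 * Suc z + 2 * Suc b + 1) 2 (Suc b)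
    * step_prod (x + 3 * Suc (Suc w) + 2 * z + 2 * Suc b + 1) 2 (Suc b) = L3 / (p + 2 * B + 7)"
    unfolding L3_def by (rule step_prod_last_div; simp add: defs)
  have S4: "step_prod ((x + 3) + w + 2 * Suc z + 2 * Suc b + 1) 2 (Suc b)
    * step_prod (x + Suc (Suc w) + 2 * z + 2 * Suc b + 1) 2 (Suc b) = L4 / (q + 5)"
    unfolding L4_def by (rule step_prod_first_div; simp add: defs)
  have S5: "step_prod ((x + 3) + w) 2 (Suc b)
    * step_prod (x + Suc (Suc w)) 2 (Suc b) = L5 * (X + Y + 1)"
    unfolding L5_def by (rule step_prod_first_mult; simp add: defs)
  have S6: "step_prod ((x + 3)) 3 (Suc b)
    * step_prod (x) 3 (Suc b) = L6"
    unfolding L6_def by (rule step_prod_last_eq; simp add: defs)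
  have S7: "step_prod ((x + 3) + 3 * w) 3 (Suc b)
    * step_prod (x + 3 * Suc (Suc w)) 3 (Suc b) = L7"
    unfolding L7_def by (rule step_prod_last_eq; simp add: defs)
  have S8: "step_prod ((x + 3) + 3 * w) 2 (Suc b)
    * step_prod (x + 3 * Suc (Suc w)) 2 (Suc b) = L8 * (X + 3 * Y + 2 * B + 3)"
    unfolding L8_def by (rule step_prod_last_mult; simp add: defs)
  have S9: "step_prod (0) 1 (Suc b)
    * step_prod (0) 1 (Suc b) = L9 / (B + 1)"
    unfolding L9_def by (rule step_prod_last_div; simp add: defs)
  have S10: "step_prod (w) 1 (Suc b)
    * step_prod (Suc (Suc w)) 1 (Suc b) = L10 / (Y)"
    unfolding L10_def by (rule step_prod_first_div; simp add: defs)
  have S11: "step_prod (2 * Suc z + 1) 2 (Suc b)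
    * step_prod (2 * z + 1) 2 (Suc b) = L11"
    unfolding L11_def by (rule step_prod_last_eq; simp add: defs)
  have S12: "step_prod (2 * w + 2 * Suc z + 1) 2 (Suc b)
    * step_prod (2 * Suc (Suc w) + 2 * z + 1) 2 (Suc b) = L12"
    unfolding L12_def by (rule step_prod_last_eq; simp add: defs)
  have S13: "step_prod ((x + 3) + w + Suc z + 2 * Suc b) 1 (Suc b)
    * step_prod (x + Suc (Suc w) + z + 2 * Suc b) 1 (Suc b) = L13 / (c + 4)"
    unfolding L13_def by (rule step_prod_first_div; simp add: defs)
  have S14: "step_prod ((x + 3) + 2 * w + Suc z + 2 * Suc b) 1 (Suc b)
    * step_prod (x + 2 * Suc (Suc w) + z + 2 * Suc b) 1 (Suc b) = L14 / (e + B + 5)"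
    unfolding L14_def by (rule step_prod_last_div; simp add: defs)
  \<comment> \<open>\<open>M\<close> is the left-hand side, and the common factor of both products
    on the right.\<close>
  define M where "M = (L1 / L2) * (L3 / L4) * (L5 / L6) * (L7 / L8) * (L9 / L10) * (L11 / L12) * (L13 / L14)"
  have mult: "(a1 / b1) * (a2 / b2) * (a3 / b3) * (a4 / b4) * (a5 / b5) * (a6 / b6) * (a7 / b7)
      * ((c1 / d1) * (c2 / d2) * (c3 / d3) * (c4 / d4) * (c5 / d5) * (c6 / d6) * (c7 / d7))
    = ((a1 * c1) / (b1 * d1)) * ((a2 * c2) / (b2 * d2)) * ((a3 * c3) / (b3 * d3)) * ((a4 * c4) / (b4 * d4))
      * ((a5 * c5) / (b5 * d5)) * ((a6 * c6) / (b6 * d6)) * ((a7 * c7) / (b7 * d7))"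
    for a1 a2 a3 a4 a5 a6 a7 b1 b2 b3 b4 b5 b6 b7 c1 c2 c3 c4 c5 c6 c7 d1 d2 d3 d4 d5 d6 d7 :: real
    by (simp add: mult_ac)
  have L: "hole_factor x (Suc w) z (b + 2) * hole_factor (x + 3) (Suc w) (Suc z) b = M"
    unfolding hole_factor_def mult M_def L_defs ..
  have R: "hole_factor (x + 3) (Suc w) z (Suc b) * hole_factor x (Suc w) (Suc z) (Suc b)
    = M * ((q + 2 * B + 7) * (X + Y + 2 * B + 3) * (Y + B + 1) * (e + 4))
      / ((p + 2 * B + 7) * (X + 3 * Y + 2 * B + 3) * (B + 1) * (c + 4))"
    unfolding hole_factor_def mult R1 R2 R3 R4 R5 R6 R7 R8 R9 R10 R11 R12 R13 R14 M_def by (simp add: mult_ac)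
  have S: "hole_factor (x + 3) w (Suc z) (Suc b) * hole_factor x (Suc (Suc w)) z (Suc b)
    = M * ((q + 5) * (X + Y + 1) * (Y) * (e + B + 5))
      / ((p + 2 * B + 7) * (X + 3 * Y + 2 * B + 3) * (B + 1) * (c + 4))"
    unfolding hole_factor_def mult S1 S2 S3 S4 S5 S6 S7 S8 S9 S10 S11 S12 S13 S14 M_def by (simp add: mult_ac)
  have pos: "p + 2 * B + 7 > 0" "X + 3 * Y + 2 * B + 3 > 0" "B + 1 > 0" "c + 4 > 0"
    by (simp_all add: defs add_nonneg_pos)
  have "(p + 2 * B + 7) * (X + 3 * Y + 2 * B + 3) * (B + 1) * (c + 4)
    = (q + 2 * B + 7) * (X + Y + 2 * B + 3) * (Y + B + 1) * (e + 4) - (q + 5) * (X + Y + 1) * Y * (e + B + 5)"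
    unfolding p_def q_def c_def e_def by Groebner_Basis.algebra
  then have "M * ((q + 2 * B + 7) * (X + Y + 2 * B + 3) * (Y + B + 1) * (e + 4))
    - M * ((q + 5) * (X + Y + 1) * Y * (e + B + 5))
    = M * ((p + 2 * B + 7) * (X + 3 * Y + 2 * B + 3) * (B + 1) * (c + 4))"
    by (simp only: right_diff_distrib)
  then show ?thesis
    unfolding L R S diff_divide_distrib[symmetric] using pos by simp
qed

section \<open>The formula for every size of the hole\<close>

text \<open>The sign of sorting the columns of \<open>path_det\<close>: the even column
  \<open>2 * (y + a - k)\<close> has to pass the \<open>z + k\<close> larger odd columns.\<close>

definition hole_sign :: "nat \<Rightarrow> nat \<Rightarrow> real" where
  "hole_sign z a = (\<Prod>k\<in>{1..a}. (-1) ^ (z + k))"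

lemma abs_hole_sign: "\<bar>hole_sign z a\<bar> = 1"
  by (simp add: hole_sign_def abs_prod power_abs)

lemma hole_sign_Suc_Suc: "hole_sign z (Suc (Suc b)) * hole_sign (Suc z) b = hole_sign z (Suc b) * hole_sign (Suc z) (Suc b)"
  by (simp add: hole_sign_def)

text \<open>In the condensation identity each product contains \<open>G\<close> and
  \<open>G'\<close> once, so the factors \<open>tri_prod\<close> drop out and
  \<open>hole_factor_condensation\<close> is what remains.\<close>

lemma path_det_eq:
  "path_det x (y + z + a) [y..<y + a] = hole_sign z a * (tri_prod (x + 3 * a) (y + z) * hole_factor x y z a)"
proof (induction a arbitrary: x y z rule: induct_nat_012)
  case 0
  show ?case by (simp add: path_det_Nil hole_factor_a_0 hole_sign_def)
next
  case 1
  let ?N = "Suc (y + z)"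
  have "kcoeff x ?N ?N * path_det x ?N [y] = tri_prod x ?N * even_sum x ?N y"
    by (simp only: path_det_single path_det_Nil)
  then have "(-1) ^ ?N * kcoeff_last x ?N * path_det x ?N [y]
    = kcoeff_last x ?N * tri_prod (x + 3) (y + z) * ((-1) ^ y * hole_factor x y z 1)"
    by (simp only: kcoeff_last tri_prod_kcoeff_last even_sum_hole_factor)
  then have "kcoeff_last x ?N * ((-1) ^ ?N * path_det x ?N [y])
    = kcoeff_last x ?N * (tri_prod (x + 3) (y + z) * ((-1) ^ y * hole_factor x y z 1))"
    by (simp only: mult_ac)
  then have "(-1) ^ ?N * path_det x ?N [y] = tri_prod (x + 3) (y + z) * ((-1) ^ y * hole_factor x y z 1)"
    using kcoeff_last_pos[of x ?N] by (metis less_irrefl mult_left_cancel)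
  then have "(-1) ^ ?N * ((-1) ^ ?N * path_det x ?N [y])
    = (-1) ^ ?N * (tri_prod (x + 3) (y + z) * ((-1) ^ y * hole_factor x y z 1))"
    by (rule arg_cong)
  moreover have "(-1) ^ ?N * ((-1) ^ ?N * d) = d" for d :: real
    by (simp add: power_mult_distrib[symmetric] mult.assoc[symmetric])
  moreover have "(-1) ^ ?N * (-1) ^ y = hole_sign z 1"
    by (simp add: hole_sign_def power_add mult_ac power_mult_distrib[symmetric])
  ultimately have "path_det x ?N [y] = hole_sign z 1 * (tri_prod (x + 3) (y + z) * hole_factor x y z 1)"
    by (metis mult.assoc mult.commute)
  then show ?case by (simp add: upt_Suc)
next
  case (ge2 b)
  let ?N = "y + z + Suc (Suc b)" and ?N' = "y + z + Suc b"
  define G G' where "G = tri_prod (x + 3 * b + 6) (y + z)" and "G' = tri_prod (x + 3 * b + 3) (Suc (y + z))"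
  have shift: "[Suc k..<Suc l] = map Suc [k..<l]" for k l by (simp add: map_Suc_upt)
  have pos: "G > 0" "G' > 0" by (simp_all add: G_def G'_def tri_prod_pos)
  have S0: "shifted_det x ?N [Suc y..<Suc (y + b)] = hole_sign (Suc z) b * (G' * hole_factor (x + 3) y (Suc z) b)"
    using ge2(1)[of "x + 3" y "Suc z"] shifted_det_Suc[of x ?N' "[y..<y + b]"]
    by (simp add: shift G'_def add_ac)
  have S1: "shifted_det x ?N [Suc y..<y + b + 2] = hole_sign z (Suc b) * (G * hole_factor (x + 3) y z (Suc b))"
    using ge2(2)[of "x + 3" y z] shifted_det_Suc[of x ?N' "[y..<y + Suc b]"]
    by (simp add: shift G_def add_ac)
  have P1: "path_det x ?N [y..<y + b + 1] = hole_sign (Suc z) (Suc b) * (G' * hole_factor x y (Suc z) (Suc b))"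
    using ge2(2)[of x y "Suc z"] by (simp add: G'_def add_ac)
  have P2: "path_det x ?N [Suc y..<y + b + 2] = hole_sign z (Suc b) * (G' * hole_factor x (Suc y) z (Suc b))"
    using ge2(2)[of x "Suc y" z] by (simp add: G'_def add_ac)
  have nz: "shifted_det x ?N [Suc y..<Suc (y + b)] \<noteq> 0"
    using pos hole_factor_pos[of "x + 3" y "Suc z" b] abs_hole_sign[of "Suc z" b] unfolding S0 by auto
  have main: "path_det x ?N [y..<y + b + 2] * shifted_det x ?N [Suc y..<Suc (y + b)]
    = hole_sign z (Suc b) * hole_sign (Suc z) (Suc b) * (G * G')
      * (hole_factor x y z (b + 2) * hole_factor (x + 3) y (Suc z) b)"
  proof -
    have cond: "path_det x ?N [y..<y + b + 2] * shifted_det x ?N [Suc y..<Suc (y + b)]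
      = path_det x ?N [y..<y + b + 1] * shifted_det x ?N [Suc y..<y + b + 2]
        - path_det x ?N [Suc y..<y + b + 2] * shifted_det x ?N [y..<y + b + 1]"
      by (rule path_det_condensation[OF nz])
    show ?thesis
    proof (cases y)
      \<comment> \<open>The subtracted product contains column 0 without row 0 and is therefore 0,
        while all hole factors are 1.\<close>
      case 0
      have "shifted_det x ?N [y..<y + b + 1] = 0"
        using shifted_det_0[of x ?N "[Suc 0..<b + 1]"] by (simp add: 0 upt_conv_Cons)
      then show ?thesis unfolding cond P1 S1 by (simp add: 0 hole_factor_y_0 mult_ac)
    next
      case (Suc w)
      have S2: "shifted_det x ?N [y..<y + b + 1] = hole_sign (Suc z) (Suc b) * (G * hole_factor (x + 3) w (Suc z) (Suc b))"
        using ge2(2)[of "x + 3" w "Suc z"] shifted_det_Suc[of x ?N' "[w..<w + Suc b]"]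
        by (simp add: shift G_def Suc add_ac)
      show ?thesis unfolding cond P1 P2 S1 S2
        unfolding Suc hole_factor_condensation by (simp only: right_diff_distrib mult_ac)
    qed
  qed
  have "hole_sign z (Suc b) * hole_sign (Suc z) (Suc b) = hole_sign z (b + 2) * hole_sign (Suc z) b"
    using hole_sign_Suc_Suc[of z b] by simp
  then have "path_det x ?N [y..<y + b + 2] * shifted_det x ?N [Suc y..<Suc (y + b)]
    = (hole_sign z (b + 2) * (G * hole_factor x y z (b + 2))) * shifted_det x ?N [Suc y..<Suc (y + b)]"
    unfolding main unfolding S0 by (simp only: mult_ac)
  then show ?case using nz by (simp add: G_def add_ac)
qed

section \<open>Comparison with the formula \<open>P1\<close>\<close>

lemma tri_prod_eq:
  "tri_prod x n = 1 / 2 ^ n * (\<Prod>i\<in>{1..n}. poch (2 * real x + 2 * real i) (int i)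
    * spoch (2 * real x + 4 * real i + 1) (int i - 1)
    / (poch (real i) (int i) * spoch (2 * real x + 2 * real i + 1) (int i - 1)))"
  unfolding tri_prod_def tri_factor_eq prod.distrib One_nat_def prod.atLeast1_atMost_eq
  by (simp add: power_divide)

lemma prod_fact_up:
  assumes "\<And>k. k < a \<Longrightarrow> f (Suc k) = s + d * k"
  shows "(\<Prod>i\<in>{1..a}. fact (f i)) = step_prod s d a"
  unfolding step_prod_def One_nat_def prod.atLeast1_atMost_eq by (rule prod.cong) (simp_all only: assms lessThan_iff)

lemma prod_fact_down:
  assumes "\<And>k. k < a \<Longrightarrow> f (a - k) = s + d * k"
  shows "(\<Prod>i\<in>{1..a}. fact (f i)) = step_prod s d a"
proof -
  have "f i = s + d * (a - i)" if "i \<in> {1..a}" for i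
    using assms[of "a - i"] that by simp
  then show ?thesis
    unfolding step_prod_def by (intro prod.reindex_bij_witness[of _ "\<lambda>k. a - k" "\<lambda>i. a - i"]) auto
qed

lemma poch_fact':
  assumes "r = real p + 1" "n = int q - int p"
  shows "poch r n = fact q / fact p"
  unfolding assms by (rule poch_fact)

text \<open>Factorials whose argument grows with \<open>i\<close> and those whose argument falls
  both give step products, the latter read backwards.\<close>

lemma hole_factor_eq:
  "hole_factor x y z a = (\<Prod>i\<in>{1..a}.
     poch (real z + real i) (int y + int a - 2 * int i + 1)
     * poch (real x + real y + 2 * real z + 2 * real a + 2 * real i) (2 * int y + 2 * int a - 4 * int i + 2)
     * poch (real x + 3 * real i - 2) (int y - int i + 1)
     * poch (real x + 3 * real y + 2 * real i - 1) (int i - 1)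
     / (poch (real i) (int y)
        * poch (real y + 2 * real z + 2 * real i - 1) (int y + 2 * int a - 4 * int i + 3)
        * poch (2 * real z + 2 * real i) (int y + 2 * int a - 4 * int i + 1)
        * poch (real x + real y + real z + 2 * real a + real i) (int y + int a - 2 * int i + 1)))"
  (is "_ = prod ?f _")
proof -
  have factor: "?f i = (fact (z + y + a - i) / fact (z + i - 1))
      * (fact (x + 3 * y + 2 * z + 4 * a + 1 - 2 * i) / fact (x + y + 2 * z + 2 * a + 2 * i - 1))
      * (fact (x + y + 2 * i - 2) / fact (x + 3 * i - 3))
      * (fact (x + 3 * y + 3 * i - 3) / fact (x + 3 * y + 2 * i - 2))
      / ((fact (y + i - 1) / fact (i - 1))
        * (fact (2 * y + 2 * z + 2 * a + 1 - 2 * i) / fact (y + 2 * z + 2 * i - 2))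
        * (fact (y + 2 * z + 2 * a - 2 * i) / fact (2 * z + 2 * i - 1))
        * (fact (x + 2 * y + z + 3 * a - i) / fact (x + y + z + 2 * a + i - 1)))"
    if "i \<in> {1..a}" for i
  proof -
    have i: "1 \<le> i" "i \<le> a" using that by simp_all
    have "poch (real z + real i) (int y + int a - 2 * int i + 1) = fact (z + y + a - i) / fact (z + i - 1)"
      by (rule poch_fact') (use i in auto)
    moreover have "poch (real x + real y + 2 * real z + 2 * real a + 2 * real i) (2 * int y + 2 * int a - 4 * int i + 2)
      = fact (x + 3 * y + 2 * z + 4 * a + 1 - 2 * i) / fact (x + y + 2 * z + 2 * a + 2 * i - 1)"
      by (rule poch_fact') (use i in auto)
    moreover have "poch (real x + 3 * real i - 2) (int y - int i + 1) = fact (x + y + 2 * i - 2) / fact (x + 3 * i - 3)"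
      by (rule poch_fact') (use i in auto)
    moreover have "poch (real x + 3 * real y + 2 * real i - 1) (int i - 1)
      = fact (x + 3 * y + 3 * i - 3) / fact (x + 3 * y + 2 * i - 2)"
      by (rule poch_fact') (use i in auto)
    moreover have "poch (real i) (int y) = fact (y + i - 1) / fact (i - 1)"
      by (rule poch_fact') (use i in auto)
    moreover have "poch (real y + 2 * real z + 2 * real i - 1) (int y + 2 * int a - 4 * int i + 3)
      = fact (2 * y + 2 * z + 2 * a + 1 - 2 * i) / fact (y + 2 * z + 2 * i - 2)"
      by (rule poch_fact') (use i in auto)
    moreover have "poch (2 * real z + 2 * real i) (int y + 2 * int a - 4 * int i + 1)
      = fact (y + 2 * z + 2 * a - 2 * i) / fact (2 * z + 2 * i - 1)"
      by (rule poch_fact') (use i in auto)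
    moreover have "poch (real x + real y + real z + 2 * real a + real i) (int y + int a - 2 * int i + 1)
      = fact (x + 2 * y + z + 3 * a - i) / fact (x + y + z + 2 * a + i - 1)"
      by (rule poch_fact') (use i in auto)
    ultimately show ?thesis by (simp only:)
  qed
  have up: "(\<Prod>i\<in>{1..a}. fact (z + i - 1)) = step_prod z 1 a"
    "(\<Prod>i\<in>{1..a}. fact (x + y + 2 * z + 2 * a + 2 * i - 1)) = step_prod (x + y + 2 * z + 2 * a + 1) 2 a"
    "(\<Prod>i\<in>{1..a}. fact (x + y + 2 * i - 2)) = step_prod (x + y) 2 a"
    "(\<Prod>i\<in>{1..a}. fact (x + 3 * i - 3)) = step_prod x 3 a"
    "(\<Prod>i\<in>{1..a}. fact (x + 3 * y + 3 * i - 3)) = step_prod (x + 3 * y) 3 a"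
    "(\<Prod>i\<in>{1..a}. fact (x + 3 * y + 2 * i - 2)) = step_prod (x + 3 * y) 2 a"
    "(\<Prod>i\<in>{1..a}. fact (y + i - 1)) = step_prod y 1 a"
    "(\<Prod>i\<in>{1..a}. fact (i - 1)) = step_prod 0 1 a"
    "(\<Prod>i\<in>{1..a}. fact (y + 2 * z + 2 * i - 2)) = step_prod (y + 2 * z) 2 a"
    "(\<Prod>i\<in>{1..a}. fact (2 * z + 2 * i - 1)) = step_prod (2 * z + 1) 2 a"
    "(\<Prod>i\<in>{1..a}. fact (x + y + z + 2 * a + i - 1)) = step_prod (x + y + z + 2 * a) 1 a"
    by (rule prod_fact_up; simp)+
  have down: "(\<Prod>i\<in>{1..a}. fact (z + y + a - i)) = step_prod (y + z) 1 a"
    "(\<Prod>i\<in>{1..a}. fact (x + 3 * y + 2 * z + 4 * a + 1 - 2 * i)) = step_prod (x + 3 * y + 2 * z + 2 * a + 1) 2 a"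
    "(\<Prod>i\<in>{1..a}. fact (2 * y + 2 * z + 2 * a + 1 - 2 * i)) = step_prod (2 * y + 2 * z + 1) 2 a"
    "(\<Prod>i\<in>{1..a}. fact (y + 2 * z + 2 * a - 2 * i)) = step_prod (y + 2 * z) 2 a"
    "(\<Prod>i\<in>{1..a}. fact (x + 2 * y + z + 3 * a - i)) = step_prod (x + 2 * y + z + 2 * a) 1 a"
    by (rule prod_fact_down; simp)+
  \<comment> \<open>\<open>c\<close> will be \<open>step_prod (y + 2 * z) 2 a\<close>. It arises
    from two Pochhammer symbols, once in increasing and once in decreasing order, so it cancels only
    after the product over \<open>i\<close> has been taken.\<close>
  have cancel: "a1 / b1 * (a2 / b2) * (a3 / b3) * (a4 / b4) * (a5 / b5) * (a6 / b6) * (a7 / b7)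
    = a1 / b1 * (a2 / b2) * (a3 / b3) * (a4 / b4) / (b5 / a5 * (b6 / c) * (c / a6) * (b7 / a7))"
    if "c > 0" for a1 a2 a3 a4 a5 a6 a7 b1 b2 b3 b4 b5 b6 b7 c :: real
    using that by simp
  have "prod ?f {1..a} = step_prod (y + z) 1 a / step_prod z 1 a
     * (step_prod (x + 3 * y + 2 * z + 2 * a + 1) 2 a / step_prod (x + y + 2 * z + 2 * a + 1) 2 a)
     * (step_prod (x + y) 2 a / step_prod x 3 a)
     * (step_prod (x + 3 * y) 3 a / step_prod (x + 3 * y) 2 a)
     / (step_prod y 1 a / step_prod 0 1 a
       * (step_prod (2 * y + 2 * z + 1) 2 a / step_prod (y + 2 * z) 2 a)
       * (step_prod (y + 2 * z) 2 a / step_prod (2 * z + 1) 2 a)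
       * (step_prod (x + 2 * y + z + 2 * a) 1 a / step_prod (x + y + z + 2 * a) 1 a))"
    by (rule trans[OF prod.cong[OF refl factor]]) (simp_all only: prod.distrib prod_dividef up down)
  then show ?thesis
    unfolding hole_factor_def using cancel[OF step_prod_pos[of "y + 2 * z" 2 a]] by (simp only:)
qed

theorem theorem4p2:
  fixes x y z a :: nat
  shows "real (card (lozenge_tilings (region_R x y z a))) = P1 x y z a"
proof -
  have "real (num_tilings (region_R x y z a)) = \<bar>path_det x (y + z + a) [y..<y + a]\<bar>"
    by (rule num_tilings_region_R)
  \<comment> \<open>Both factors are positive, so the absolute value only removes
    \<open>hole_sign\<close>.\<close>
  also have "\<dots> = tri_prod (x + 3 * a) (y + z) * hole_factor x y z a"
    using tri_prod_pos[of "x + 3 * a" "y + z"] hole_factor_pos[of x y z a]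
    by (simp add: path_det_eq abs_mult abs_hole_sign)
  also have "\<dots> = P1 x y z a"
    unfolding tri_prod_eq hole_factor_eq P1_def by simp
  finally show ?thesis .
qed

end
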